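(* Let $(T,r)$ be a locally compact $\mathbb{R}$-tree with a fixed root $\rho\in T$ and length measure $\lambda^{(T,r)}$, and let $f:T\to\mathbb{R}$ be locally absolutely continuous. Then there exists a unique (up to $\lambda^{(T,r)}$-zero sets) function $g\in L^1_{\mathrm{loc}}(\lambda^{(T,r)})$ such that $$f(y)-f(x)=\int_x^y\lambda^{(T,r)}(\mathrm{d}z)\,g(z)\qquad\text{for all }x,y\in T.$$ Moreover, $g$ is already uniquely determined (up to $\lambda^{(T,r)}$-zero sets) if this identity is only required to hold for all $x,y\in T$ with $x\in[\rho,y]$.
   Context: An $\mathbb{R}$-tree is a metric space $(T,r)$ such that (1) for all $u,v\in T$ there is a unique isometric embedding $\phi_{u,v}:[0,r(u,v)]\to T$ with $\phi_{u,v}(0)=u$, $\phi_{u,v}(r(u,v))=v$; (2) every injective continuous $\kappa:[0,1]\to T$ satisfies $\kappa([0,1])=\phi_{\kappa(0),\kappa(1)}([0,r(\kappa(0),\kappa(1))])$. Write $[a,b]=\phi_{a,b}([0,r(a,b)])$ and $]a,b[=\phi_{a,b}(]0,r(a,b)[)$. For $a,b,x\in T$, $c(a,b,x)$ is the unique point with $[a,x]\cap[a,b]=[a,c(a,b,x)]$. Length measure: locally compact $\mathbb{R}$-trees are separable; $\lambda^{(T,r)}$ is the unique $\sigma$-finite Borel measure on $T$ with $\lambda^{(T,r)}(]a,b[)=r(a,b)$ for all $a,b\in T$ and $\lambda^{(T,r)}(T\setminus T^o)=0$, where $T^o=\bigcup_{a,b\in T}]a,b[$. Put $x\wedge y:=c(\rho,x,y)$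 and $\int_x^y\lambda^{(T,r)}(\mathrm{d}z)\,g(z):=-\int_{[x\wedge y,x]}g\,\mathrm{d}\lambda^{(T,r)}+\int_{[x\wedge y,y]}g\,\mathrm{d}\lambda^{(T,r)}$. Here $g\in L^1_{\mathrm{loc}}(\lambda^{(T,r)})$ means that $g$ is Borel measurable and $\lambda^{(T,r)}$-integrable over every arc $[a,b]$. A continuous $f:T\to\mathbb{R}$ is locally absolutely continuous if for every $\varepsilon>0$ and every $S\subseteq T$ with $\lambda^{(T,r)}(S)<\infty$ there is $\delta>0$ such that for disjoint arcs $[x_1,y_1],\dots,[x_n,y_n]\subseteq S$ with $\sum_ir(x_i,y_i)<\delta$ one has $\sum_i|f(x_i)-f(y_i)|<\varepsilon$. *)

theory Defs
  imports "HOL-Analysis.Analysis"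
begin

text \<open>
  A metric space \<open>(T, r)\<close> is rendered as a type of class \<^class>\<open>metric_space\<close>, with \<open>T = UNIV\<close> and
  \<open>r = dist\<close>.
\<close>

text \<open>
  Isometric embeddings of \<open>[0, r(u,v)]\<close> are total functions on the reals that are
  \<^const>\<open>undefined\<close> outside the interval, so that uniqueness of the embedding is equality of functions.
\<close>

definition geodesic :: "'a::metric_space \<Rightarrow> 'a \<Rightarrow> (real \<Rightarrow> 'a) \<Rightarrow> bool" where
  "geodesic u v \<phi> \<longleftrightarrow>
     \<phi> \<in> extensional {0..dist u v} \<and>
     (\<forall>s\<in>{0..dist u v}. \<forall>t\<in>{0..dist u v}. dist (\<phi> s) (\<phi> t) = \<bar>s - t\<bar>) \<and>
     \<phi> 0 = u \<and> \<phi> (dist u v) = v"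

definition the_geodesic :: "'a::metric_space \<Rightarrow> 'a \<Rightarrow> real \<Rightarrow> 'a" where
  "the_geodesic u v = (THE \<phi>. geodesic u v \<phi>)"

definition tree_arc :: "'a::metric_space \<Rightarrow> 'a \<Rightarrow> 'a set" where
  "tree_arc a b = the_geodesic a b ` {0..dist a b}"

definition open_tree_arc :: "'a::metric_space \<Rightarrow> 'a \<Rightarrow> 'a set" where
  "open_tree_arc a b = the_geodesic a b ` {0<..<dist a b}"

text \<open>The library's \<^const>\<open>arc\<close> is an injective continuous map on \<open>{0..1}\<close>.\<close>

definition real_tree :: "'a::metric_space itself \<Rightarrow> bool" where
  "real_tree _ \<longleftrightarrow>
     (\<forall>u v :: 'a. \<exists>!\<phi>. geodesic u v \<phi>) \<and>
     (\<forall>\<kappa> :: real \<Rightarrow> 'a. arc \<kappa> \<longrightarrow> path_image \<kappa> = tree_arc (pathstart \<kappa>) (pathfinish \<kappa>))"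

definition branch_point :: "'a::metric_space \<Rightarrow> 'a \<Rightarrow> 'a \<Rightarrow> 'a" where
  "branch_point a b x = (THE c. tree_arc a x \<inter> tree_arc a b = tree_arc a c)"

definition skeleton :: "'a::metric_space set" where
  "skeleton = (\<Union>a b. open_tree_arc a b)"

text \<open>
  Membership in \<^const>\<open>null_sets\<close>, rather than \<open>emeasure L (- skeleton) = 0\<close>, because
  \<^const>\<open>emeasure\<close> is \<open>0\<close> on every non-measurable set.
\<close>

definition length_measure :: "'a::metric_space measure \<Rightarrow> bool" where
  "length_measure L \<longleftrightarrow>
     sets L = sets borel \<and> sigma_finite_measure L \<and>
     (\<forall>a b. emeasure L (open_tree_arc a b) = ennreal (dist a b)) \<and>
     UNIV - skeleton \<in> null_sets L"

definition L1_loc :: "'a::metric_space measure \<Rightarrow> ('a \<Rightarrow> real) set" where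
  "L1_loc L = {g \<in> borel_measurable borel. \<forall>a b. set_integrable L (tree_arc a b) g}"

definition tree_integral ::
    "'a::metric_space \<Rightarrow> 'a measure \<Rightarrow> 'a \<Rightarrow> 'a \<Rightarrow> ('a \<Rightarrow> real) \<Rightarrow> real" where
  "tree_integral \<rho> L x y g =
     - (LINT z:tree_arc (branch_point \<rho> x y) x|L. g z)
     + (LINT z:tree_arc (branch_point \<rho> x y) y|L. g z)"

text \<open>
  The sets \<open>S\<close> range over measurable sets only, again because \<^const>\<open>emeasure\<close> is \<open>0\<close> on all others.
\<close>

definition locally_absolutely_continuous ::
    "'a::metric_space measure \<Rightarrow> ('a \<Rightarrow> real) \<Rightarrow> bool" where
  "locally_absolutely_continuous L f \<longleftrightarrow>
     continuous_on UNIV f \<and>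
     (\<forall>\<epsilon>>0. \<forall>S\<in>sets L. emeasure L S < \<infinity> \<longrightarrow>
       (\<exists>\<delta>>0. \<forall>(n::nat) x y.
          disjoint_family_on (\<lambda>i. tree_arc (x i) (y i)) {..<n} \<and>
          (\<forall>i<n. tree_arc (x i) (y i) \<subseteq> S) \<and>
          (\<Sum>i<n. dist (x i) (y i)) < \<delta> \<longrightarrow>
          (\<Sum>i<n. \<bar>f (x i) - f (y i)\<bar>) < \<epsilon>))"

end

theory Submission
  imports Defs
begin

text \<open>
  Along an arc \<open>[\<rho>,y]\<close> the distance to \<open>\<rho>\<close> carries \<open>\<lambda>\<close> to Lebesgue measure on \<open>[0,r(\<rho>,y)]\<close> and \<open>f\<close> to an
  absolutely continuous function of one variable. The latter is a difference of two nondecreasing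
  absolutely continuous functions, namely its positive variation and the remainder, and the
  Lebesgue-Stieltjes measures of these have densities by Radon-Nikodym. Since a density on an interval
  is determined by its integrals over subintervals, the densities for two arcs agree almost
  everywhere on their intersection, which is again an arc from \<open>\<rho>\<close>.

  Exhaustion with respect to the \<open>\<sigma>\<close>-finite measure \<open>\<lambda>\<close> gives countably many arcs \<open>[\<rho>,y\<^sub>n]\<close> whose union
  covers every \<open>[\<rho>,x]\<close> up to a null set; being closed under passing to points closer to \<open>\<rho>\<close>, the union
  then contains the whole skeleton. Gluing the densities along these arcs gives \<open>g\<close>, and uniqueness
  follows arc by arc.
\<close>

section \<open>Absolutely continuous functions on an interval\<close>

text \<open>Local absolute continuity is applied with \<open>S\<close> an arc, which has finite
  length. It speaks of disjoint closed arcs, whereas cutting and refining intervals produces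
  neighbours with common endpoints. The one-variable notion therefore asks for disjoint interiors
  only, and \<open>abs_continuous_on_disjointI\<close> bridges the gap.

  Radon-Nikodym requires every Lebesgue null set to be null for the Lebesgue-Stieltjes measure,
  while increments control finite unions of intervals only. Inner regularity reduces the question to
  compact null sets, where finitely many intervals do suffice.

  The obstacle in gluing is that a tree may have uncountably many arcs from the root, each with a
  density fixed only up to a null set. Countably many of them have to be selected before exceptional
  sets may be united.

  Arcs from the root suffice for the whole statement: the integral from \<open>x\<close> to
  \<open>y\<close> is a difference of integrals over two arcs starting at the branch point, which
  lies on both [\<rho>,x] and [\<rho>,y]. Uniqueness is proved under the weaker requirement, which
  settles both uniqueness claims.\<close>

definition interval_family :: "real \<Rightarrow> real \<Rightarrow> 'i set \<Rightarrow> ('i \<Rightarrow> real) \<Rightarrow> ('i \<Rightarrow> real) \<Rightarrow> bool" where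
  "interval_family a b I x y \<longleftrightarrow>
     finite I \<and> (\<forall>i\<in>I. a \<le> x i \<and> x i \<le> y i \<and> y i \<le> b) \<and>
     disjoint_family_on (\<lambda>i. {x i<..<y i}) I"

text \<open>A definition has to fix the index type, here \<open>nat\<close>;
  \<open>abs_continuous_onE\<close> frees it again. Since only the interiors in an
  \<open>interval_family\<close> are disjoint, such families survive cutting and refining.\<close>

definition abs_continuous_on :: "real \<Rightarrow> real \<Rightarrow> (real \<Rightarrow> real) \<Rightarrow> bool" where
  "abs_continuous_on a b F \<longleftrightarrow>
     (\<forall>\<epsilon>>0. \<exists>\<delta>>0. \<forall>(I :: nat set) x y.
        interval_family a b I x y \<longrightarrow> (\<Sum>i\<in>I. y i - x i) < \<delta> \<longrightarrow>
        (\<Sum>i\<in>I. \<bar>F (y i) - F (x i)\<bar>) < \<epsilon>)"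

section \<open>Finite families of non-overlapping intervals\<close>

lemma interval_family_emeasure:
  assumes "interval_family a b I x y"
  shows "emeasure lborel (\<Union>i\<in>I. {x i<..<y i}) = ennreal (\<Sum>i\<in>I. y i - x i)"
proof -
  have I: "finite I" "\<And>i. i \<in> I \<Longrightarrow> x i \<le> y i"
    "disjoint_family_on (\<lambda>i. {x i<..<y i}) I"
    using assms by (auto simp: interval_family_def)
  have "ennreal (\<Sum>i\<in>I. y i - x i) = (\<Sum>i\<in>I. emeasure lborel {x i<..<y i})"
    using I by (subst sum_ennreal[symmetric]) (auto intro!: sum.cong)
  also have "\<dots> = emeasure lborel (\<Union>i\<in>I. {x i<..<y i})"
    using I by (intro sum_emeasure) auto
  finally show ?thesis ..
qed

lemma interval_family_length:
  assumes fam: "interval_family a b I x y" and "a \<le> b"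
  shows "(\<Sum>i\<in>I. y i - x i) \<le> b - a"
proof -
  have "{x i<..<y i} \<subseteq> {a..b}" if "i \<in> I" for i
    using fam that by (force simp: interval_family_def)
  then have "emeasure lborel (\<Union>i\<in>I. {x i<..<y i}) \<le> emeasure lborel {a..b}"
    by (intro emeasure_mono) auto
  then show ?thesis
    using \<open>a \<le> b\<close> by (simp add: interval_family_emeasure[OF fam] ennreal_le_iff)
qed

lemma interval_family_subset:
  assumes "interval_family a b I x y" "J \<subseteq> I"
  shows "interval_family a b J x y"
  using assms by (auto simp: interval_family_def disjoint_family_on_def intro: finite_subset)

lemma interval_family_mono:
  assumes "interval_family a b I x y" "a' \<le> a" "b \<le> b'"
  shows "interval_family a' b' I x y"
  using assms by (auto simp: interval_family_def)

lemma interval_family_shrink: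
  assumes fam: "interval_family a b I x y"
    and bounds: "\<And>i. i \<in> I \<Longrightarrow> a' \<le> x' i \<and> x' i \<le> y' i \<and> y' i \<le> b'"
    and sub: "\<And>i. i \<in> I \<Longrightarrow> {x' i<..<y' i} \<subseteq> {x i<..<y i}"
  shows "interval_family a' b' I x' y'"
  unfolding interval_family_def disjoint_family_on_def
proof (intro conjI ballI impI)
  fix i j assume "i \<in> I" "j \<in> I" "i \<noteq> j"
  then have "{x i<..<y i} \<inter> {x j<..<y j} = {}"
    using fam by (simp add: interval_family_def disjoint_family_on_def)
  then show "{x' i<..<y' i} \<inter> {x' j<..<y' j} = {}"
    using sub[OF \<open>i \<in> I\<close>] sub[OF \<open>j \<in> I\<close>] by blast
qed (use fam bounds in \<open>auto simp: interval_family_def\<close>)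

lemma interval_family_cut:
  assumes fam: "interval_family a b I x y" and "a \<le> c" "c \<le> b"
  shows "interval_family a c I (\<lambda>i. min (x i) c) (\<lambda>i. min (y i) c)"
    and "interval_family c b I (\<lambda>i. max (x i) c) (\<lambda>i. max (y i) c)"
proof -
  have *: "a \<le> x i" "x i \<le> y i" "y i \<le> b" if "i \<in> I" for i
    using fam that by (auto simp: interval_family_def)
  show "interval_family a c I (\<lambda>i. min (x i) c) (\<lambda>i. min (y i) c)"
  proof (rule interval_family_shrink[OF fam])
    fix i assume "i \<in> I"
    from *[OF this] show "a \<le> min (x i) c \<and> min (x i) c \<le> min (y i) c \<and> min (y i) c \<le> c"
      using \<open>a \<le> c\<close> by auto
  qed auto
  show "interval_family c b I (\<lambda>i. max (x i) c) (\<lambda>i. max (y i) c)"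
  proof (rule interval_family_shrink[OF fam])
    fix i assume "i \<in> I"
    from *[OF this] show "c \<le> max (x i) c \<and> max (x i) c \<le> max (y i) c \<and> max (y i) c \<le> b"
      using \<open>c \<le> b\<close> by auto
  qed auto
qed

text \<open>The points \<open>min y c\<close> and \<open>max y c\<close> are \<open>y\<close> and
  \<open>c\<close> in some order and together contribute \<open>F y + F c\<close>. The same holds
  for \<open>x\<close>, and \<open>F c\<close> cancels, wherever \<open>c\<close> lies.\<close>

lemma increment_cut:
  fixes F :: "real \<Rightarrow> real"
  shows "F y - F x = (F (min y c) - F (min x c)) + (F (max y c) - F (max x c))"
  by (auto simp: min_def max_def)

lemma interval_family_bij:
  assumes "interval_family a b I x y" "bij_betw h J I"
  shows "interval_family a b J (x \<circ> h) (y \<circ> h)"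
proof -
  have inj: "inj_on h J" and im: "h ` J = I"
    using assms(2) by (auto simp: bij_betw_def)
  then show ?thesis
    using assms(1) bij_betw_finite[OF assms(2)]
    unfolding interval_family_def disjoint_family_on_def o_def
    by (metis image_eqI inj_onD)
qed

text \<open>Renumbering a finite index set leaves the sums unchanged. The freedom is used for a
  family of families, indexed by pairs, in \<open>abs_continuous_on_pos_variation\<close>.\<close>

lemma abs_continuous_onE:
  assumes "abs_continuous_on a b F" "\<epsilon> > 0"
  obtains \<delta> where "\<delta> > 0"
    "\<And>(I :: 'i set) x y. interval_family a b I x y \<Longrightarrow> (\<Sum>i\<in>I. y i - x i) < \<delta> \<Longrightarrow>
        (\<Sum>i\<in>I. \<bar>F (y i) - F (x i)\<bar>) < \<epsilon>"
proof -
  obtain \<delta> where \<delta>: "\<delta> > 0"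
    "\<And>(I :: nat set) x y. interval_family a b I x y \<Longrightarrow> (\<Sum>i\<in>I. y i - x i) < \<delta> \<Longrightarrow>
        (\<Sum>i\<in>I. \<bar>F (y i) - F (x i)\<bar>) < \<epsilon>"
    using assms unfolding abs_continuous_on_def by blast
  show thesis
  proof (rule that[OF \<delta>(1)])
    fix I :: "'i set" and x y
    assume fam: "interval_family a b I x y" and less: "(\<Sum>i\<in>I. y i - x i) < \<delta>"
    then obtain h where h: "bij_betw h {0..<card I} I"
      using ex_bij_betw_nat_finite unfolding interval_family_def by blast
    have "(\<Sum>i\<in>{0..<card I}. \<bar>F ((y \<circ> h) i) - F ((x \<circ> h) i)\<bar>) < \<epsilon>"
      using less h by (intro \<delta>(2) interval_family_bij[OF fam])
        (simp_all add: sum.reindex_bij_betw[OF h, of "\<lambda>i. y i - x i"])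
    then show "(\<Sum>i\<in>I. \<bar>F (y i) - F (x i)\<bar>) < \<epsilon>"
      by (simp add: sum.reindex_bij_betw[OF h, of "\<lambda>i. \<bar>F (y i) - F (x i)\<bar>"])
  qed
qed

section \<open>Bounded variation and the positive variation\<close>

lemma abs_continuous_on_bounded_variation:
  assumes F: "abs_continuous_on a b F" and "a \<le> b"
  obtains B where "\<And>(I :: nat set) x y. interval_family a b I x y \<Longrightarrow> (\<Sum>i\<in>I. \<bar>F (y i) - F (x i)\<bar>) \<le> B"
proof -
  obtain \<delta> where \<delta>: "\<delta> > 0"
    "\<And>(I :: nat set) x y. interval_family a b I x y \<Longrightarrow> (\<Sum>i\<in>I. y i - x i) < \<delta> \<Longrightarrow>
        (\<Sum>i\<in>I. \<bar>F (y i) - F (x i)\<bar>) < 1"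
    using abs_continuous_onE[OF F zero_less_one] by metis
  \<comment> \<open>Division points with spacing at most \<delta>/2, capped at \<open>b\<close>.
    Each piece is shorter than \<delta>, so a family inside it has variation below 1; the induction
    on \<open>k\<close> adds one piece at a time, and finitely many pieces exhaust [a,b].\<close>
  define c where "c k = min b (a + real k * (\<delta> / 2))" for k
  have c: "a \<le> c k" "c k \<le> c (Suc k)" "c k \<le> b" "c (Suc k) - c k < \<delta>" for k
    using \<open>a \<le> b\<close> \<open>\<delta> > 0\<close> by (auto simp: c_def min_def field_simps)
  have *: "(\<Sum>i\<in>I. \<bar>F (y i) - F (x i)\<bar>) \<le> real k"
    if "interval_family a (c k) I x y" for I :: "nat set" and x y k
    using that
  proof (induction k arbitrary: x y)
    case 0
    then have "\<forall>i\<in>I. x i = y i"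
      using \<open>a \<le> b\<close> by (force simp: interval_family_def c_def)
    then show ?case by simp
  next
    case (Suc k)
    note cut = interval_family_cut[OF Suc.prems c(1,2)]
    have "(\<Sum>i\<in>I. \<bar>F (y i) - F (x i)\<bar>) \<le>
      (\<Sum>i\<in>I. \<bar>F (min (y i) (c k)) - F (min (x i) (c k))\<bar> + \<bar>F (max (y i) (c k)) - F (max (x i) (c k))\<bar>)"
    proof (rule sum_mono)
      fix i
      show "\<bar>F (y i) - F (x i)\<bar> \<le> \<bar>F (min (y i) (c k)) - F (min (x i) (c k))\<bar> + \<bar>F (max (y i) (c k)) - F (max (x i) (c k))\<bar>"
        using increment_cut[of F "y i" "x i" "c k"] by linarith
    qed
    also have "\<dots> = (\<Sum>i\<in>I. \<bar>F (min (y i) (c k)) - F (min (x i) (c k))\<bar>) + (\<Sum>i\<in>I. \<bar>F (max (y i) (c k)) - F (max (x i) (c k))\<bar>)"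
      by (rule sum.distrib)
    also have "(\<Sum>i\<in>I. \<bar>F (min (y i) (c k)) - F (min (x i) (c k))\<bar>) \<le> real k"
      by (rule Suc.IH[OF cut(1)])
    also have "(\<Sum>i\<in>I. \<bar>F (max (y i) (c k)) - F (max (x i) (c k))\<bar>) < 1"
      using interval_family_length[OF cut(2) c(2)] c(4)[of k]
      by (intro \<delta>(2) interval_family_mono[OF cut(2) c(1) c(3)]) linarith
    finally show ?case by simp
  qed
  obtain k where "(b - a) / (\<delta> / 2) \<le> real k"
    using real_arch_simple by blast
  then have "c k = b"
    using \<open>\<delta> > 0\<close> by (simp add: c_def field_simps)
  then show thesis
    using that * by metis
qed

text \<open>The summands are signed, but a family need not cover [a,t]: intervals on which
  \<open>F\<close> falls can be left out, so the supremum is the positive variation.\<close>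

definition pos_variation :: "real \<Rightarrow> (real \<Rightarrow> real) \<Rightarrow> real \<Rightarrow> real" where
  "pos_variation a F t =
     (SUP (I, x, y) \<in> {(I :: nat set, x, y). interval_family a t I x y}. \<Sum>i\<in>I. F (y i) - F (x i))"

context
  fixes a b :: real and F :: "real \<Rightarrow> real"
  assumes ab: "a \<le> b" and F: "abs_continuous_on a b F"
begin

text \<open>A supremum of reals bounds its members only when they are bounded above; the bound on
  the total variation over [a,b] provides this.\<close>

lemma pos_variation_upper:
  fixes I :: "nat set"
  assumes "interval_family a t I x y" "t \<le> b"
  shows "(\<Sum>i\<in>I. F (y i) - F (x i)) \<le> pos_variation a F t"
proof -
  obtain B where B: "\<And>(I :: nat set) x y. interval_family a b I x y \<Longrightarrow> (\<Sum>i\<in>I. \<bar>F (y i) - F (x i)\<bar>) \<le> B"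
    using abs_continuous_on_bounded_variation[OF F ab] by blast
  have "bdd_above ((\<lambda>(I, x, y). \<Sum>i\<in>I. F (y i) - F (x i)) ` {(I :: nat set, x, y). interval_family a t I x y})"
  proof (rule bdd_aboveI2, clarify)
    fix I :: "nat set" and x y assume fam: "interval_family a t I x y"
    have "(\<Sum>i\<in>I. F (y i) - F (x i)) \<le> (\<Sum>i\<in>I. \<bar>F (y i) - F (x i)\<bar>)"
      by (rule sum_mono) simp
    also have "\<dots> \<le> B"
      using B interval_family_mono[OF fam order_refl \<open>t \<le> b\<close>] .
    finally show "(\<Sum>i\<in>I. F (y i) - F (x i)) \<le> B" .
  qed
  from cSUP_upper[OF _ this, of "(I, x, y)"] show ?thesis
    using assms by (simp add: pos_variation_def)
qed

lemma pos_variation_approx: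
  assumes "\<eta> > 0"
  obtains I :: "nat set" and x y where "interval_family a t I x y"
    "pos_variation a F t < (\<Sum>i\<in>I. F (y i) - F (x i)) + \<eta>"
proof -
  have "({}, \<lambda>_. 0, \<lambda>_. 0) \<in> {(I :: nat set, x, y). interval_family a t I x y}"
    by (simp add: interval_family_def disjoint_family_on_def)
  then have "\<exists>z \<in> (\<lambda>(I, x, y). \<Sum>i\<in>I. F (y i) - F (x i)) ` {(I :: nat set, x, y). interval_family a t I x y}.
     pos_variation a F t - \<eta> < z"
    unfolding pos_variation_def using assms
    by (intro less_cSupD) auto
  then show thesis
    using that by (auto simp: algebra_simps)
qed

text \<open>Adjoining ]s,t[ to a nearly optimal family on [a,s] gives an admissible family on [a,t].
  Rearranged, positive variation minus \<open>F\<close> is nondecreasing.\<close>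

lemma pos_variation_increment_ge:
  assumes "a \<le> s" "s \<le> t" "t \<le> b"
  shows "F t - F s \<le> pos_variation a F t - pos_variation a F s"
proof (rule field_le_epsilon)
  fix \<eta> :: real assume "\<eta> > 0"
  then obtain I :: "nat set" and x y where fam: "interval_family a s I x y"
    and less: "pos_variation a F s < (\<Sum>i\<in>I. F (y i) - F (x i)) + \<eta>"
    by (rule pos_variation_approx)
  obtain j where j: "j \<notin> I"
    using fam ex_new_if_finite infinite_UNIV_nat unfolding interval_family_def by blast
  have "{x i<..<y i} \<inter> {s<..<t} = {}" if "i \<in> I" for i
    using fam that by (auto simp: interval_family_def)
  then have "interval_family a t (insert j I) (x(j := s)) (y(j := t))"
    using fam j assms unfolding interval_family_def disjoint_family_on_def
    by (intro conjI ballI impI) (auto split: if_splits)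
  from pos_variation_upper[OF this \<open>t \<le> b\<close>]
  have "(F t - F s) + (\<Sum>i\<in>I. F ((y(j := t)) i) - F ((x(j := s)) i)) \<le> pos_variation a F t"
    using j fam by (simp add: interval_family_def)
  also have "(\<Sum>i\<in>I. F ((y(j := t)) i) - F ((x(j := s)) i)) = (\<Sum>i\<in>I. F (y i) - F (x i))"
    using j by (intro sum.cong) auto
  finally show "F t - F s \<le> pos_variation a F t - pos_variation a F s + \<eta>"
    using less by simp
qed

lemma pos_variation_mono:
  assumes "a \<le> s" "s \<le> t" "t \<le> b"
  shows "pos_variation a F s \<le> pos_variation a F t"
proof (rule field_le_epsilon)
  fix \<eta> :: real assume "\<eta> > 0"
  then obtain I :: "nat set" and x y where fam: "interval_family a s I x y"
    and less: "pos_variation a F s < (\<Sum>i\<in>I. F (y i) - F (x i)) + \<eta>"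
    by (rule pos_variation_approx)
  with pos_variation_upper[OF interval_family_mono[OF fam order_refl \<open>s \<le> t\<close>] \<open>t \<le> b\<close>]
  show "pos_variation a F s \<le> pos_variation a F t + \<eta>" by linarith
qed

text \<open>Cut a nearly optimal family on [a,t] at \<open>s\<close>. Its left half contributes at
  most the positive variation up to \<open>s\<close>, so the right half nearly attains the
  increment.\<close>

lemma pos_variation_increment_approx:
  assumes "a \<le> s" "s \<le> t" "t \<le> b" "\<eta> > 0"
  obtains I :: "nat set" and x y where "interval_family s t I x y"
    "pos_variation a F t - pos_variation a F s < (\<Sum>i\<in>I. F (y i) - F (x i)) + \<eta>"
proof -
  obtain I :: "nat set" and x y where fam: "interval_family a t I x y"
    and less: "pos_variation a F t < (\<Sum>i\<in>I. F (y i) - F (x i)) + \<eta>"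
    using pos_variation_approx[OF \<open>\<eta> > 0\<close>] by blast
  note cut = interval_family_cut[OF fam \<open>a \<le> s\<close> \<open>s \<le> t\<close>]
  have "(\<Sum>i\<in>I. F (y i) - F (x i)) =
    (\<Sum>i\<in>I. F (min (y i) s) - F (min (x i) s)) + (\<Sum>i\<in>I. F (max (y i) s) - F (max (x i) s))"
    unfolding sum.distrib[symmetric] by (intro sum.cong refl increment_cut)
  moreover have "(\<Sum>i\<in>I. F (min (y i) s) - F (min (x i) s)) \<le> pos_variation a F s"
    using assms by (intro pos_variation_upper[OF cut(1)]) auto
  ultimately show thesis
    using less by (intro that[OF cut(2)]) linarith
qed

text \<open>Inside each [s j, t j] choose a family nearly attaining the increment of the positive
  variation. All these together form one family, indexed by pairs and of no greater total length, to
  which the absolute continuity of \<open>F\<close> applies.\<close>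

lemma abs_continuous_on_pos_variation: "abs_continuous_on a b (pos_variation a F)"
  unfolding abs_continuous_on_def
proof (intro allI impI)
  fix \<epsilon> :: real assume "\<epsilon> > 0"
  then have "\<epsilon> / 3 > 0" by simp
  from abs_continuous_onE[OF F this] obtain \<delta> where \<delta>: "\<delta> > 0"
    "\<And>(I :: (nat \<times> nat) set) x y. interval_family a b I x y \<Longrightarrow> (\<Sum>i\<in>I. y i - x i) < \<delta> \<Longrightarrow>
        (\<Sum>i\<in>I. \<bar>F (y i) - F (x i)\<bar>) < \<epsilon> / 3"
    by metis
  show "\<exists>\<delta>>0. \<forall>(I :: nat set) x y. interval_family a b I x y \<longrightarrow> (\<Sum>i\<in>I. y i - x i) < \<delta> \<longrightarrow>
        (\<Sum>i\<in>I. \<bar>pos_variation a F (y i) - pos_variation a F (x i)\<bar>) < \<epsilon>"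
  proof (intro exI[of _ \<delta>] conjI allI impI)
    fix J :: "nat set" and s t
    assume J: "interval_family a b J s t" and less: "(\<Sum>j\<in>J. t j - s j) < \<delta>"
    have fin: "finite J" and st: "\<And>j. j \<in> J \<Longrightarrow> a \<le> s j \<and> s j \<le> t j \<and> t j \<le> b"
      and disj: "disjoint_family_on (\<lambda>i. {s i<..<t i}) J"
      using J by (auto simp: interval_family_def)
    \<comment> \<open>The approximation errors sum to at most \<epsilon>/3 over \<open>J\<close>;
      the \<open>+ 1\<close> covers empty \<open>J\<close>.\<close>
    define \<eta> where "\<eta> = \<epsilon> / (3 * (real (card J) + 1))"
    have "\<eta> > 0" using \<open>\<epsilon> > 0\<close> by (simp add: \<eta>_def)
    have "\<forall>j. \<exists>I x y. j \<in> J \<longrightarrow> interval_family (s j) (t j) (I :: nat set) x y \<and>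
       pos_variation a F (t j) - pos_variation a F (s j) < (\<Sum>i\<in>I. F (y i) - F (x i)) + \<eta>"
      using pos_variation_increment_approx[OF _ _ _ \<open>\<eta> > 0\<close>] st by metis
    then obtain I :: "nat \<Rightarrow> nat set" and x y where
      fam: "\<And>j. j \<in> J \<Longrightarrow> interval_family (s j) (t j) (I j) (x j) (y j)" and
      approx: "\<And>j. j \<in> J \<Longrightarrow> pos_variation a F (t j) - pos_variation a F (s j)
        < (\<Sum>i\<in>I j. F (y j i) - F (x j i)) + \<eta>"
      by metis
    have finI: "\<And>j. j \<in> J \<Longrightarrow> finite (I j)"
      using fam by (auto simp: interval_family_def)
    have "interval_family a b (Sigma J I) (\<lambda>(j, i). x j i) (\<lambda>(j, i). y j i)"
      unfolding interval_family_def
    proof (intro conjI)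
      show "finite (Sigma J I)" using fin finI by auto
      show "\<forall>i\<in>Sigma J I. a \<le> (case i of (j, i) \<Rightarrow> x j i) \<and>
          (case i of (j, i) \<Rightarrow> x j i) \<le> (case i of (j, i) \<Rightarrow> y j i) \<and> (case i of (j, i) \<Rightarrow> y j i) \<le> b"
      proof clarsimp
        fix j i assume "j \<in> J" "i \<in> I j"
        then have "s j \<le> x j i \<and> x j i \<le> y j i \<and> y j i \<le> t j"
          using fam[of j] by (simp add: interval_family_def)
        then show "a \<le> x j i \<and> x j i \<le> y j i \<and> y j i \<le> b"
          using st[OF \<open>j \<in> J\<close>] by linarith
      qed
      show "disjoint_family_on (\<lambda>i. {case i of (j, i) \<Rightarrow> x j i<..<case i of (j, i) \<Rightarrow> y j i}) (Sigma J I)"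
        unfolding disjoint_family_on_def
      proof (intro ballI impI)
        fix p q assume pq: "p \<in> Sigma J I" "q \<in> Sigma J I" "p \<noteq> q"
        obtain j i j' i' where eq: "p = (j, i)" "q = (j', i')" by fastforce
        then have ji: "j \<in> J" "i \<in> I j" "j' \<in> J" "i' \<in> I j'" using pq by auto
        have sub: "{x j i<..<y j i} \<subseteq> {s j<..<t j}" if "j \<in> J" "i \<in> I j" for j i
          using fam[OF that(1)] that(2) by (auto simp: interval_family_def)
        have "{x j i<..<y j i} \<inter> {x j' i'<..<y j' i'} = {}"
        proof (cases "j = j'")
          case True
          then show ?thesis
            using ji eq pq(3) fam[of j] by (simp add: interval_family_def disjoint_family_on_def)
        next
          case False
          then have "{s j<..<t j} \<inter> {s j'<..<t j'} = {}"
            using disj ji unfolding disjoint_family_on_def by blast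
          then show ?thesis using sub[OF ji(1,2)] sub[OF ji(3,4)] by blast
        qed
        then show "{case p of (j, i) \<Rightarrow> x j i<..<case p of (j, i) \<Rightarrow> y j i} \<inter>
            {case q of (j, i) \<Rightarrow> x j i<..<case q of (j, i) \<Rightarrow> y j i} = {}"
          by (simp only: eq prod.case)
      qed
    qed
    moreover have "(\<Sum>(j, i)\<in>Sigma J I. y j i - x j i) < \<delta>"
    proof -
      have "(\<Sum>(j, i)\<in>Sigma J I. y j i - x j i) = (\<Sum>j\<in>J. \<Sum>i\<in>I j. y j i - x j i)"
        using fin finI by (subst sum.Sigma) auto
      also have "\<dots> \<le> (\<Sum>j\<in>J. t j - s j)"
        using fam st by (intro sum_mono interval_family_length) auto
      finally show ?thesis using less by simp
    qed
    ultimately have small: "(\<Sum>(j, i)\<in>Sigma J I. \<bar>F (y j i) - F (x j i)\<bar>) < \<epsilon> / 3"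
      using \<delta>(2)[of "Sigma J I" "\<lambda>(j, i). x j i" "\<lambda>(j, i). y j i"] by (simp add: split_def)
    have "(\<Sum>j\<in>J. \<bar>pos_variation a F (t j) - pos_variation a F (s j)\<bar>) \<le>
        (\<Sum>j\<in>J. (\<Sum>i\<in>I j. \<bar>F (y j i) - F (x j i)\<bar>) + \<eta>)"
    proof (rule sum_mono)
      fix j assume j: "j \<in> J"
      have "\<bar>pos_variation a F (t j) - pos_variation a F (s j)\<bar> = pos_variation a F (t j) - pos_variation a F (s j)"
        using st[OF j] pos_variation_mono by simp
      also have "\<dots> \<le> (\<Sum>i\<in>I j. F (y j i) - F (x j i)) + \<eta>"
        using approx[OF j] by simp
      also have "(\<Sum>i\<in>I j. F (y j i) - F (x j i)) \<le> (\<Sum>i\<in>I j. \<bar>F (y j i) - F (x j i)\<bar>)"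
        by (rule sum_mono) simp
      finally show "\<bar>pos_variation a F (t j) - pos_variation a F (s j)\<bar> \<le>
        (\<Sum>i\<in>I j. \<bar>F (y j i) - F (x j i)\<bar>) + \<eta>" by simp
    qed
    also have "\<dots> = (\<Sum>(j, i)\<in>Sigma J I. \<bar>F (y j i) - F (x j i)\<bar>) + real (card J) * \<eta>"
      using fin finI by (subst sum.Sigma[symmetric]) (auto simp: sum.distrib)
    also have "\<dots> < \<epsilon> / 3 + \<epsilon> / 3"
    proof (rule add_less_le_mono[OF small])
      show "real (card J) * \<eta> \<le> \<epsilon> / 3"
        using \<open>\<epsilon> > 0\<close> by (simp add: \<eta>_def field_simps)
    qed
    finally show "(\<Sum>j\<in>J. \<bar>pos_variation a F (t j) - pos_variation a F (s j)\<bar>) < \<epsilon>"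
      using \<open>\<epsilon> > 0\<close> by simp
  qed (rule \<open>\<delta> > 0\<close>)
qed

end

section \<open>Densities of absolutely continuous functions\<close>

lemma abs_continuous_on_diff:
  assumes "abs_continuous_on a b F" "abs_continuous_on a b G"
  shows "abs_continuous_on a b (\<lambda>x. F x - G x)"
  unfolding abs_continuous_on_def
proof (intro allI impI)
  fix \<epsilon> :: real assume "\<epsilon> > 0"
  then have "\<epsilon> / 2 > 0" by simp
  obtain \<delta> where \<delta>: "\<delta> > 0"
    "\<And>(I :: nat set) x y. interval_family a b I x y \<Longrightarrow> (\<Sum>i\<in>I. y i - x i) < \<delta> \<Longrightarrow>
        (\<Sum>i\<in>I. \<bar>F (y i) - F (x i)\<bar>) < \<epsilon> / 2"
    using abs_continuous_onE[OF assms(1) \<open>\<epsilon> / 2 > 0\<close>] by metis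
  obtain \<delta>' where \<delta>': "\<delta>' > 0"
    "\<And>(I :: nat set) x y. interval_family a b I x y \<Longrightarrow> (\<Sum>i\<in>I. y i - x i) < \<delta>' \<Longrightarrow>
        (\<Sum>i\<in>I. \<bar>G (y i) - G (x i)\<bar>) < \<epsilon> / 2"
    using abs_continuous_onE[OF assms(2) \<open>\<epsilon> / 2 > 0\<close>] by metis
  show "\<exists>\<delta>>0. \<forall>(I :: nat set) x y. interval_family a b I x y \<longrightarrow> (\<Sum>i\<in>I. y i - x i) < \<delta> \<longrightarrow>
        (\<Sum>i\<in>I. \<bar>F (y i) - G (y i) - (F (x i) - G (x i))\<bar>) < \<epsilon>"
  proof (intro exI[of _ "min \<delta> \<delta>'"] conjI allI impI)
    fix I :: "nat set" and x y
    assume "interval_family a b I x y" "(\<Sum>i\<in>I. y i - x i) < min \<delta> \<delta>'"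
    then have "(\<Sum>i\<in>I. \<bar>F (y i) - F (x i)\<bar>) < \<epsilon> / 2" "(\<Sum>i\<in>I. \<bar>G (y i) - G (x i)\<bar>) < \<epsilon> / 2"
      using \<delta>(2) \<delta>'(2) by auto
    moreover have "(\<Sum>i\<in>I. \<bar>F (y i) - G (y i) - (F (x i) - G (x i))\<bar>) \<le>
      (\<Sum>i\<in>I. \<bar>F (y i) - F (x i)\<bar> + \<bar>G (y i) - G (x i)\<bar>)"
      by (rule sum_mono) linarith
    ultimately show "(\<Sum>i\<in>I. \<bar>F (y i) - G (y i) - (F (x i) - G (x i))\<bar>) < \<epsilon>"
      by (simp add: sum.distrib)
  qed (use \<delta>(1) \<delta>'(1) in auto)
qed

text \<open>
  A compact null set is covered by those cells of a fine grid that meet it; the cells lie in an open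
  set of small length, so the increments of \<open>G\<close> over them add up to little.
\<close>

lemma absolutely_continuous_interval_measure:
  fixes G :: "real \<Rightarrow> real"
  assumes mono: "\<And>s t. s \<le> t \<Longrightarrow> G s \<le> G t" and cont: "continuous_on UNIV G"
    and left: "\<And>t. t \<le> a \<Longrightarrow> G t = G a" and right: "\<And>t. b \<le> t \<Longrightarrow> G t = G b"
    and "a \<le> b" and AC: "abs_continuous_on a b G"
  shows "absolutely_continuous lborel (interval_measure G)"
proof -
  let ?\<mu> = "interval_measure G"
  have Ioc: "emeasure ?\<mu> {s<..t} = ennreal (G t - G s)" if "s \<le> t" for s t
  proof (rule emeasure_interval_measure_Ioc[OF that mono])
    show "continuous (at_right x) G" for x
      using cont by (simp add: continuous_on_eq_continuous_at continuous_at_imp_continuous_at_within)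
  qed
  \<comment> \<open>\<open>G\<close> is constant to the left of \<open>a\<close> and to the right of
    \<open>b\<close>, so half-open intervals there carry no mass; the point \<open>a\<close> itself
    belongs to the left ones.\<close>
  have outside: "UNIV - {a<..b} \<in> null_sets ?\<mu>"
  proof -
    have "{a - real n<..a} \<union> {b<..b + real n} \<in> null_sets ?\<mu>" for n :: nat
      using left[of "a - real n"] right[of "b + real n"]
      by (intro null_sets.Un) (simp_all add: null_sets_def Ioc)
    then have "(\<Union>n. {a - real n<..a} \<union> {b<..b + real n}) \<in> null_sets ?\<mu>"
      by (intro null_sets_UN) auto
    moreover have "(\<Union>n. {a - real n<..a} \<union> {b<..b + real n}) = UNIV - {a<..b}" (is "?U = _")
    proof -
      have "t \<in> ?U" if "t \<notin> {a<..b}" for t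
      proof -
        obtain n where "\<bar>t - a\<bar> + \<bar>t - b\<bar> < real n" using reals_Archimedean2 by blast
        then show ?thesis using that \<open>a \<le> b\<close> by (intro UN_I[of n]) auto
      qed
      then show ?thesis using \<open>a \<le> b\<close> by auto
    qed
    ultimately show ?thesis by simp
  qed
  have "emeasure ?\<mu> UNIV \<le> emeasure ?\<mu> (UNIV - {a<..b}) + emeasure ?\<mu> {a<..b}"
    using emeasure_subadditive[of "UNIV - {a<..b}" ?\<mu> "{a<..b}"] by simp
  also have "\<dots> = ennreal (G b - G a)"
    using outside Ioc[OF \<open>a \<le> b\<close>] by (simp add: null_sets_def)
  \<comment> \<open>Finite total mass is what inner regularity asks for at the end.\<close>
  finally have fin: "emeasure ?\<mu> (space ?\<mu>) \<noteq> \<infinity>"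
    by (auto simp: top_unique)
  have compact_null: "emeasure ?\<mu> K = 0" if K: "compact K" "emeasure lborel K = 0" for K
  proof -
    have "emeasure ?\<mu> K \<le> 0 + ennreal \<epsilon>" if "\<epsilon> > 0" for \<epsilon>
    proof -
      from abs_continuous_onE[OF AC that] obtain \<delta> where \<delta>: "\<delta> > 0"
        "\<And>(I :: nat set) x y. interval_family a b I x y \<Longrightarrow> (\<Sum>i\<in>I. y i - x i) < \<delta> \<Longrightarrow>
          (\<Sum>i\<in>I. \<bar>G (y i) - G (x i)\<bar>) < \<epsilon>"
        by metis
      have Kb[measurable]: "K \<in> sets borel"
        using K by (simp add: borel_compact)
      obtain U where U: "open U" "K \<subseteq> U" "emeasure lborel (U - K) < ennreal \<delta>"
        using outer_regular_lborel[OF Kb \<open>\<delta> > 0\<close>] .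
      have U\<delta>: "emeasure lborel U < ennreal \<delta>"
      proof -
        have "emeasure lborel U \<le> emeasure lborel (U - K) + emeasure lborel K"
          using emeasure_subadditive[of "U - K" lborel K] U Kb by (simp add: Un_absorb2)
        with U(3) K(2) show ?thesis by simp
      qed
      \<comment> \<open>By compactness one margin \<eta> serves all points of \<open>K\<close>, so a
        cell shorter than \<eta> that meets \<open>K\<close> has its interior inside
        \<open>U\<close>.\<close>
      obtain \<eta> where \<eta>: "\<eta> > 0" "\<And>x y. x \<in> K \<Longrightarrow> dist x y < \<eta> \<Longrightarrow> y \<in> U"
      proof (cases "K = {}")
        case False
        obtain \<eta> where "\<eta> > 0" and sub: "{x. infdist x K \<le> \<eta>} \<subseteq> U"
          using compact_in_open_separated[OF False K(1) U(1,2)] .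
        have "y \<in> U" if "x \<in> K" "dist x y < \<eta>" for x y
          using infdist_le[OF that(1), of y] that(2) sub by (auto simp: dist_commute)
        then show thesis using that \<open>\<eta> > 0\<close> by blast
      qed (use that[of 1] in auto)
      obtain m :: nat where "(b - a) / \<eta> < real m"
        using reals_Archimedean2 by blast
      moreover have "0 \<le> (b - a) / \<eta>"
        using \<open>\<eta> > 0\<close> \<open>a \<le> b\<close> by simp
      ultimately have "0 < real m" by linarith
      with \<open>(b - a) / \<eta> < real m\<close> have m: "(b - a) / real m < \<eta>" "0 < m"
        using \<open>\<eta> > 0\<close> by (simp_all add: field_simps)
      define h where "h = (b - a) / real m"
      define c where "c i = a + real i * h" for i
      have h: "0 \<le> h" "h < \<eta>" "real m * h = b - a"
        using m \<open>a \<le> b\<close> by (auto simp: h_def)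
      have c_mono: "c i \<le> c j" if "i \<le> j" for i j
        using that h(1) by (auto simp: c_def intro!: mult_right_mono)
      have c0: "c 0 = a" and cm: "c m = b" and cSuc: "c (Suc i) = c i + h" for i
        using h by (auto simp: c_def algebra_simps)
      \<comment> \<open>Cells open on the left tile ]a,b], hence cover the part of \<open>K\<close>
        in it; their interiors form the family to which absolute continuity applies.\<close>
      define J where "J = {i. i < m \<and> {c i<..c (Suc i)} \<inter> K \<noteq> {}}"
      have fam: "interval_family a b J c (\<lambda>i. c (Suc i))"
        unfolding interval_family_def disjoint_family_on_def
      proof (intro conjI ballI impI)
        fix i j :: nat assume "i \<noteq> j"
        then show "{c i<..<c (Suc i)} \<inter> {c j<..<c (Suc j)} = {}"
          using c_mono[of "Suc i" j] c_mono[of "Suc j" i] by (cases "i < j") auto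
      next
        fix i assume "i \<in> J"
        then show "a \<le> c i" "c i \<le> c (Suc i)" "c (Suc i) \<le> b"
          using c_mono[of 0 i] c_mono[of i "Suc i"] c_mono[of "Suc i" m] c0 cm
          by (auto simp: J_def)
      qed (simp add: J_def)
      have "{c i<..<c (Suc i)} \<subseteq> U" if "i \<in> J" for i
      proof
        fix x assume x: "x \<in> {c i<..<c (Suc i)}"
        from that obtain k where k: "k \<in> K" "k \<in> {c i<..c (Suc i)}" unfolding J_def by blast
        have "dist k x < \<eta>" using x k(2) h(2) cSuc[of i] by (auto simp: dist_real_def)
        then show "x \<in> U" using \<eta>(2) k(1) by blast
      qed
      then have "emeasure lborel (\<Union>i\<in>J. {c i<..<c (Suc i)}) \<le> emeasure lborel U"
        using U(1) by (intro emeasure_mono) auto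
      then have "ennreal (\<Sum>i\<in>J. c (Suc i) - c i) < ennreal \<delta>"
        using U\<delta> by (simp add: interval_family_emeasure[OF fam])
      then have "(\<Sum>i\<in>J. c (Suc i) - c i) < \<delta>"
        by (metis ennreal_leI linorder_not_le)
      from \<delta>(2)[OF fam this] have small: "(\<Sum>i\<in>J. \<bar>G (c (Suc i)) - G (c i)\<bar>) < \<epsilon>" .
      have "K \<subseteq> (UNIV - {a<..b}) \<union> (\<Union>i\<in>J. {c i<..c (Suc i)})"
      proof
        fix x assume "x \<in> K"
        show "x \<in> (UNIV - {a<..b}) \<union> (\<Union>i\<in>J. {c i<..c (Suc i)})"
        proof (cases "x \<in> {a<..b}")
          case True
          then have ex: "\<exists>j. x \<le> c j" using cm by auto
          \<comment> \<open>The first grid point not left of \<open>x\<close> is the right end of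
            the cell containing \<open>x\<close>. It is not \<open>c 0\<close>, because a <
            x.\<close>
          define j where "j = (LEAST j. x \<le> c j)"
          have "x \<le> c j" unfolding j_def using ex by (rule LeastI_ex)
          moreover have "j \<noteq> 0"
            using True \<open>x \<le> c j\<close> c0 by (intro notI) auto
          then obtain i where i: "j = Suc i" by (cases j) auto
          moreover have "\<not> x \<le> c i"
            using i not_less_Least[of i "\<lambda>j. x \<le> c j"] by (simp add: j_def)
          moreover have "j \<le> m" unfolding j_def using True cm by (intro Least_le) auto
          ultimately have "x \<in> {c i<..c (Suc i)}" "i < m"
            by auto
          then have "i \<in> J" using \<open>x \<in> K\<close> unfolding J_def by blast
          with \<open>x \<in> {c i<..c (Suc i)}\<close> show ?thesis by blast
        qed simp
      qed
      then have "emeasure ?\<mu> K \<le> emeasure ?\<mu> ((UNIV - {a<..b}) \<union> (\<Union>i\<in>J. {c i<..c (Suc i)}))"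
        by (intro emeasure_mono) auto
      also have "\<dots> \<le> emeasure ?\<mu> (UNIV - {a<..b}) + emeasure ?\<mu> (\<Union>i\<in>J. {c i<..c (Suc i)})"
        by (intro emeasure_subadditive) auto
      also have "emeasure ?\<mu> (\<Union>i\<in>J. {c i<..c (Suc i)}) \<le> (\<Sum>i\<in>J. emeasure ?\<mu> {c i<..c (Suc i)})"
        by (intro emeasure_subadditive_finite) (auto simp: J_def)
      also have "\<dots> = ennreal (\<Sum>i\<in>J. \<bar>G (c (Suc i)) - G (c i)\<bar>)"
        using c_mono mono by (subst sum_ennreal[symmetric]) (auto intro!: sum.cong simp: Ioc)
      also have "\<dots> \<le> ennreal \<epsilon>" using small by (intro ennreal_leI) simp
      finally show ?thesis
        using outside by (simp add: null_sets_def)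
    qed
    then have "emeasure ?\<mu> K \<le> 0"
      by (rule ennreal_le_epsilon) auto
    then show ?thesis by simp
  qed
  show ?thesis
    unfolding absolutely_continuous_def
  proof
    fix N assume "N \<in> null_sets (lborel :: real measure)"
    then have N: "N \<in> sets borel" "emeasure lborel N = 0" by (auto simp: null_sets_def)
    have "emeasure ?\<mu> N = (SUP K\<in>{K. K \<subseteq> N \<and> compact K}. emeasure ?\<mu> K)"
      using N(1) fin by (intro inner_regular) auto
    also have "\<dots> = 0"
    proof -
      have "emeasure ?\<mu> K = 0" if "K \<subseteq> N" "compact K" for K
        using N emeasure_mono[OF that(1), of lborel] by (intro compact_null that) auto
      then show ?thesis by (auto simp: SUP_eq_iff intro!: SUP_eq_const)
    qed
    finally show "N \<in> null_sets ?\<mu>" using N by (simp add: null_sets_def)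
  qed
qed

text \<open>A family consisting of the single interval between \<open>s\<close> and \<open>t\<close>
  already gives the estimate.\<close>

lemma abs_continuous_on_imp_continuous_on:
  assumes "abs_continuous_on a b F"
  shows "continuous_on {a..b} F"
  unfolding continuous_on_iff
proof (intro ballI allI impI)
  fix t and \<epsilon> :: real assume t: "t \<in> {a..b}" and "\<epsilon> > 0"
  from abs_continuous_onE[OF assms \<open>\<epsilon> > 0\<close>] obtain \<delta> where \<delta>: "\<delta> > 0"
    "\<And>(I :: nat set) x y. interval_family a b I x y \<Longrightarrow> (\<Sum>i\<in>I. y i - x i) < \<delta> \<Longrightarrow>
       (\<Sum>i\<in>I. \<bar>F (y i) - F (x i)\<bar>) < \<epsilon>"
    by metis
  have "dist (F s) (F t) < \<epsilon>" if s: "s \<in> {a..b}" "dist s t < \<delta>" for s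
    using \<delta>(2)[of "{0}" "\<lambda>_. min s t" "\<lambda>_. max s t"] s t
    by (cases "s \<le> t")
      (auto simp: interval_family_def disjoint_family_on_def dist_real_def abs_minus_commute)
  then show "\<exists>d>0. \<forall>s\<in>{a..b}. dist s t < d \<longrightarrow> dist (F s) (F t) < \<epsilon>"
    using \<delta>(1) by blast
qed

lemma abs_continuous_on_mono_density:
  assumes AC: "abs_continuous_on a b F" and "a \<le> b"
    and mono: "\<And>s t. a \<le> s \<Longrightarrow> s \<le> t \<Longrightarrow> t \<le> b \<Longrightarrow> F s \<le> F t"
  obtains g :: "real \<Rightarrow> real" where "g \<in> borel_measurable borel" "set_integrable lborel {a..b} g"
    "\<And>s t. a \<le> s \<Longrightarrow> s \<le> t \<Longrightarrow> t \<le> b \<Longrightarrow> F t - F s = (LINT x:{s..t}|lborel. g x)"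
proof -
  \<comment> \<open>Clamping the argument extends \<open>F\<close> by constants, since
    \<open>interval_measure\<close> takes a function on the whole line; continuity and monotonicity
    survive.\<close>
  define G where "G t = F (max a (min b t))" for t
  have GF: "G t = F t" if "t \<in> {a..b}" for t using that by (simp add: G_def)
  have Gmono: "G s \<le> G t" if "s \<le> t" for s t
    unfolding G_def using that \<open>a \<le> b\<close> by (intro mono) auto
  have Gcont: "continuous_on UNIV G"
    unfolding G_def
    by (rule continuous_on_compose2[OF abs_continuous_on_imp_continuous_on[OF AC]])
      (use \<open>a \<le> b\<close> in \<open>auto intro!: continuous_intros\<close>)
  have GAC: "abs_continuous_on a b G"
    unfolding abs_continuous_on_def
  proof (intro allI impI)
    fix \<epsilon> :: real assume "\<epsilon> > 0"
    from abs_continuous_onE[OF AC this] obtain \<delta> where \<delta>: "\<delta> > 0"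
      "\<And>(I :: nat set) x y. interval_family a b I x y \<Longrightarrow> (\<Sum>i\<in>I. y i - x i) < \<delta> \<Longrightarrow>
         (\<Sum>i\<in>I. \<bar>F (y i) - F (x i)\<bar>) < \<epsilon>"
      by metis
    have "(\<Sum>i\<in>I. \<bar>G (y i) - G (x i)\<bar>) = (\<Sum>i\<in>I. \<bar>F (y i) - F (x i)\<bar>)"
      if fam: "interval_family a b I x y" for I :: "nat set" and x y
    proof (rule sum.cong)
      fix i assume "i \<in> I"
      then have "x i \<in> {a..b}" "y i \<in> {a..b}"
        using fam by (force simp: interval_family_def)+
      then show "\<bar>G (y i) - G (x i)\<bar> = \<bar>F (y i) - F (x i)\<bar>" by (simp add: GF)
    qed simp
    then show "\<exists>\<delta>>0. \<forall>(I :: nat set) x y. interval_family a b I x y \<longrightarrow> (\<Sum>i\<in>I. y i - x i) < \<delta> \<longrightarrow>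
        (\<Sum>i\<in>I. \<bar>G (y i) - G (x i)\<bar>) < \<epsilon>"
      using \<delta> by (intro exI[of _ \<delta>]) auto
  qed
  have "absolutely_continuous lborel (interval_measure G)"
    by (rule absolutely_continuous_interval_measure[OF Gmono Gcont _ _ \<open>a \<le> b\<close> GAC])
      (use \<open>a \<le> b\<close> in \<open>auto simp: G_def\<close>)
  from sigma_finite_measure.Radon_Nikodym[OF sigma_finite_lborel this] obtain u :: "real \<Rightarrow> ennreal"
    where u[measurable]: "u \<in> borel_measurable borel" and dens: "density lborel u = interval_measure G"
    by auto
  have nn: "(\<integral>\<^sup>+x. u x * indicator {s..t} x \<partial>lborel) = ennreal (F t - F s)"
    if "a \<le> s" "s \<le> t" "t \<le> b" for s t
  proof -
    have "(\<integral>\<^sup>+x. u x * indicator {s..t} x \<partial>lborel) = emeasure (interval_measure G) {s..t}"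
      unfolding dens[symmetric] by (simp add: emeasure_density)
    also have "\<dots> = ennreal (F t - F s)"
      using that GF Gmono Gcont by (subst emeasure_interval_measure_Icc) auto
    finally show ?thesis .
  qed
  \<comment> \<open>Where \<open>u\<close> is infinite, \<open>enn2real\<close> returns 0.
    Finiteness of the integral of \<open>u\<close> over [a,b] confines this to a null set within
    [a,b].\<close>
  define g where "g x = enn2real (u x)" for x
  have [measurable]: "g \<in> borel_measurable borel" unfolding g_def by measurable
  have "AE x in lborel. u x * indicator {a..b} x \<noteq> \<infinity>"
    using nn[of a b] \<open>a \<le> b\<close> by (intro nn_integral_PInf_AE) auto
  then have gu: "AE x in lborel. ennreal (indicat_real {s..t} x * g x) = u x * indicator {s..t} x"
    if "a \<le> s" "t \<le> b" for s t
    using that by (auto elim!: eventually_mono simp: g_def indicator_def less_top split: if_splits)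
  have nng: "(\<integral>\<^sup>+x. ennreal (indicat_real {s..t} x * g x) \<partial>lborel) = ennreal (F t - F s)"
    if "a \<le> s" "s \<le> t" "t \<le> b" for s t
    using nn[OF that] nn_integral_cong_AE[OF gu[OF that(1,3)]] by simp
  have "set_integrable lborel {a..b} g"
    unfolding set_integrable_def real_scaleR_def
    by (rule integrableI_nonneg) (use nng[of a b] \<open>a \<le> b\<close> in \<open>auto simp: g_def\<close>)
  moreover have "F t - F s = (LINT x:{s..t}|lborel. g x)" if "a \<le> s" "s \<le> t" "t \<le> b" for s t
    unfolding set_lebesgue_integral_def real_scaleR_def
    by (subst integral_eq_nn_integral) (use nng[OF that] mono[OF that] in \<open>auto simp: g_def\<close>)
  ultimately show thesis using that[OF \<open>g \<in> borel_measurable borel\<close>] by blast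
qed

theorem abs_continuous_on_density:
  assumes AC: "abs_continuous_on a b F" and "a \<le> b"
  obtains g :: "real \<Rightarrow> real" where "g \<in> borel_measurable borel" "set_integrable lborel {a..b} g"
    "\<And>s t. a \<le> s \<Longrightarrow> s \<le> t \<Longrightarrow> t \<le> b \<Longrightarrow> F t - F s = (LINT x:{s..t}|lborel. g x)"
proof -
  let ?P = "pos_variation a F"
  note P = abs_continuous_on_pos_variation[OF \<open>a \<le> b\<close> AC]
  obtain p :: "real \<Rightarrow> real" where p: "p \<in> borel_measurable borel" "set_integrable lborel {a..b} p"
    "\<And>s t. a \<le> s \<Longrightarrow> s \<le> t \<Longrightarrow> t \<le> b \<Longrightarrow> ?P t - ?P s = (LINT x:{s..t}|lborel. p x)"
    using pos_variation_mono[OF \<open>a \<le> b\<close> AC] by (rule abs_continuous_on_mono_density[OF P \<open>a \<le> b\<close>]) blast+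
  have "?P s - F s \<le> ?P t - F t" if "a \<le> s" "s \<le> t" "t \<le> b" for s t
    using pos_variation_increment_ge[OF \<open>a \<le> b\<close> AC that] by simp
  then obtain q :: "real \<Rightarrow> real" where q: "q \<in> borel_measurable borel" "set_integrable lborel {a..b} q"
    "\<And>s t. a \<le> s \<Longrightarrow> s \<le> t \<Longrightarrow> t \<le> b \<Longrightarrow> (?P t - F t) - (?P s - F s) = (LINT x:{s..t}|lborel. q x)"
    by (rule abs_continuous_on_mono_density[OF abs_continuous_on_diff[OF P AC] \<open>a \<le> b\<close>]) blast+
  show thesis
  proof (rule that[of "\<lambda>x. p x - q x"])
    show "(\<lambda>x. p x - q x) \<in> borel_measurable borel" using p(1) q(1) by simp
    show "set_integrable lborel {a..b} (\<lambda>x. p x - q x)" using p(2) q(2) by (rule set_integral_diff)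
    fix s t assume st: "a \<le> s" "s \<le> t" "t \<le> b"
    then have "{s..t} \<subseteq> {a..b}" by auto
    then have "set_integrable lborel {s..t} p" "set_integrable lborel {s..t} q"
      using set_integrable_subset p(2) q(2) by fastforce+
    from set_integral_diff(2)[OF this] show "F t - F s = (LINT x:{s..t}|lborel. p x - q x)"
      using p(3)[OF st] q(3)[OF st] by simp
  qed
qed

text \<open>The positive and the negative part of \<open>k\<close> on [a,b] are densities of two
  finite measures. These agree on half-lines, hence everywhere, so the two parts agree almost
  everywhere; as one of them is always 0, both vanish.\<close>

lemma set_integral_intervals_zero_AE:
  fixes k :: "real \<Rightarrow> real"
  assumes k: "set_integrable lborel {a..b} k"
    and zero: "\<And>s t. a \<le> s \<Longrightarrow> s \<le> t \<Longrightarrow> t \<le> b \<Longrightarrow> (LINT x:{s..t}|lborel. k x) = 0"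
  shows "AE x in lborel. x \<in> {a..b} \<longrightarrow> k x = 0"
proof -
  define u where "u x = indicat_real {a..b} x * k x" for x
  have u: "integrable lborel u" using k by (simp add: u_def[abs_def] set_integrable_def)
  then have [measurable]: "u \<in> borel_measurable borel" by auto
  \<comment> \<open>\<open>ennreal\<close> sends negative reals to 0, so the densities are the
    positive and negative parts.\<close>
  let ?M = "density lborel (\<lambda>x. ennreal (u x))" and ?N = "density lborel (\<lambda>x. ennreal (- u x))"
  have int: "integrable lborel (\<lambda>x. indicat_real {t<..} x * u x)" for t
    using integrable_mult_indicator[OF _ u, of "{t<..}"] by simp
  have emeasure_eq:
    "emeasure ?M {t<..} = (\<integral>\<^sup>+x. ennreal (indicat_real {t<..} x * u x) \<partial>lborel)"
    "emeasure ?N {t<..} = (\<integral>\<^sup>+x. ennreal (- (indicat_real {t<..} x * u x)) \<partial>lborel)" for t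
    by (auto simp: emeasure_density indicator_def intro!: nn_integral_cong)
  have fin: "emeasure ?M {t<..} < \<infinity>" "emeasure ?N {t<..} < \<infinity>" for t
    using int[of t] unfolding emeasure_eq real_integrable_def by (auto simp: less_top)
  have "?M = ?N"
  proof (rule measure_eqI_lessThan)
    fix t
    have "(\<integral>x. indicat_real {t<..} x * u x \<partial>lborel) = (LINT x:{max a t..b}|lborel. k x)"
      unfolding set_lebesgue_integral_def
    proof (rule integral_cong_AE)
      show "AE x in lborel. indicat_real {t<..} x * u x = indicat_real {max a t..b} x *\<^sub>R k x"
        \<comment> \<open>The half-line omits the point \<open>t\<close>, which the closed interval
          may contain.\<close>
        using AE_lborel_singleton[of t]
        by eventually_elim (auto simp: u_def indicator_def)
      show "(\<lambda>x. indicat_real {max a t..b} x *\<^sub>R k x) \<in> borel_measurable lborel"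
        using set_integrable_subset[OF k, of "{max a t..b}"]
        by (auto simp: set_integrable_def)
    qed simp
    also have "\<dots> = 0"
      using zero[of "max a t" b] by (cases "max a t \<le> b") (auto simp: set_lebesgue_integral_def)
    finally have "enn2real (emeasure ?M {t<..}) = enn2real (emeasure ?N {t<..})"
      unfolding real_lebesgue_integral_def[OF int] emeasure_eq by simp
    then show "emeasure ?M {t<..} = emeasure ?N {t<..}"
      using fin[of t] by (metis ennreal_enn2real infinity_ennreal_def)
  qed (use fin in auto)
  then have "AE x in lborel. ennreal (u x) = ennreal (- u x)"
    by (intro sigma_finite_measure.density_unique[OF sigma_finite_lborel]) auto
  then show ?thesis
  proof eventually_elim
    fix x assume "ennreal (u x) = ennreal (- u x)"
    then have "u x = 0"
      by (cases "0 \<le> u x") (auto simp: ennreal_neg ennreal_eq_0_iff)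
    then show "x \<in> {a..b} \<longrightarrow> k x = 0" by (auto simp: u_def)
  qed
qed

text \<open>Intervals with common endpoints are separated by shrinking them; continuity restores them.\<close>

lemma abs_continuous_on_disjointI:
  fixes F :: "real \<Rightarrow> real"
  assumes cont: "continuous_on UNIV F"
    and disj: "\<And>\<epsilon>. \<epsilon> > 0 \<Longrightarrow> \<exists>\<delta>>0. \<forall>(n :: nat) x y.
      (\<forall>i<n. a \<le> x i \<and> x i \<le> y i \<and> y i \<le> b) \<longrightarrow> disjoint_family_on (\<lambda>i. {x i..y i}) {..<n} \<longrightarrow>
      (\<Sum>i<n. y i - x i) < \<delta> \<longrightarrow> (\<Sum>i<n. \<bar>F (y i) - F (x i)\<bar>) < \<epsilon>"
  shows "abs_continuous_on a b F"
  unfolding abs_continuous_on_def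
proof (intro allI impI)
  fix \<epsilon> :: real assume "\<epsilon> > 0"
  then have "\<epsilon> / 2 > 0" by simp
  from disj[OF this] obtain \<delta> where \<delta>: "\<delta> > 0"
    "\<And>(n :: nat) x y. (\<And>i. i < n \<Longrightarrow> a \<le> x i \<and> x i \<le> y i \<and> y i \<le> b) \<Longrightarrow>
      disjoint_family_on (\<lambda>i. {x i..y i}) {..<n} \<Longrightarrow>
      (\<Sum>i<n. y i - x i) < \<delta> \<Longrightarrow> (\<Sum>i<n. \<bar>F (y i) - F (x i)\<bar>) < \<epsilon> / 2"
    by blast
  have "(\<Sum>i\<in>I. \<bar>F (y i) - F (x i)\<bar>) < \<epsilon>"
    if fam0: "interval_family a b I x y" and less0: "(\<Sum>i\<in>I. y i - x i) < \<delta>" for I :: "nat set" and x y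
  proof -
    \<comment> \<open>Shrinking separates only intervals of positive length. Degenerate ones
      contribute nothing to either sum and are dropped.\<close>
    define J where "J = {i\<in>I. x i < y i}"
    have fin: "finite I" and J: "J \<subseteq> I" "finite J"
      using fam0 by (auto simp: J_def interval_family_def)
    have eq: "x i = y i" if "i \<in> I - J" for i
      using that fam0 by (force simp: J_def interval_family_def)
    obtain h where h: "bij_betw h {0..<card J} J"
      using ex_bij_betw_nat_finite[OF J(2)] by blast
    let ?n = "card J"
    have hJ: "h i \<in> J" if "i < ?n" for i using h that by (auto simp: bij_betw_def)
    have fam: "interval_family a b {0..<?n} (x \<circ> h) (y \<circ> h)"
      by (rule interval_family_bij[OF interval_family_subset[OF fam0 J(1)] h])
    \<comment> \<open>Both ends move inwards by the fraction \<eta> of the length; \<eta> < 1/2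
      keeps them in order. The limit \<eta> -> 0 weakens a strict bound to a weak one, hence the
      bound \<epsilon>/2 for the shrunken intervals.\<close>
    define X Y where "X \<eta> i = x (h i) + \<eta> * (y (h i) - x (h i))"
      and "Y \<eta> i = y (h i) - \<eta> * (y (h i) - x (h i))" for \<eta> i
    have less: "(\<Sum>i<?n. y (h i) - x (h i)) < \<delta>"
    proof -
      have "(\<Sum>i<?n. y (h i) - x (h i)) = (\<Sum>i\<in>J. y i - x i)"
        using sum.reindex_bij_betw[OF h, of "\<lambda>i. y i - x i"] by (simp add: atLeast0LessThan)
      also have "\<dots> = (\<Sum>i\<in>I. y i - x i)"
        using J fin eq by (intro sum.mono_neutral_left) auto
      finally show ?thesis using less0 by simp
    qed
    have shrunk: "(\<Sum>i<?n. \<bar>F (Y \<eta> i) - F (X \<eta> i)\<bar>) \<le> \<epsilon> / 2" if \<eta>: "0 < \<eta>" "\<eta> < 1 / 2" for \<eta>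
    proof -
      have XY: "x (h i) < X \<eta> i \<and> X \<eta> i \<le> Y \<eta> i \<and> Y \<eta> i < y (h i)" if "i < ?n" for i
      proof -
        define d where "d = y (h i) - x (h i)"
        have "0 < d" using hJ[OF that] by (simp add: J_def d_def)
        then have "0 < \<eta> * d" "\<eta> * d < 1 / 2 * d"
          using \<eta> by (auto intro: mult_strict_right_mono)
        moreover have "X \<eta> i = x (h i) + \<eta> * d" "Y \<eta> i = y (h i) - \<eta> * d" "y (h i) = x (h i) + d"
          by (simp_all add: X_def Y_def d_def)
        ultimately show ?thesis by linarith
      qed
      have "(\<Sum>i<?n. \<bar>F (Y \<eta> i) - F (X \<eta> i)\<bar>) < \<epsilon> / 2"
      proof (rule \<delta>(2))
        fix i assume "i < ?n"
        then have "a \<le> x (h i)" "y (h i) \<le> b"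
          using fam by (simp_all add: interval_family_def)
        then show "a \<le> X \<eta> i \<and> X \<eta> i \<le> Y \<eta> i \<and> Y \<eta> i \<le> b"
          using XY[OF \<open>i < ?n\<close>] by linarith
      next
        show "disjoint_family_on (\<lambda>i. {X \<eta> i..Y \<eta> i}) {..<?n}"
          unfolding disjoint_family_on_def
        proof (intro ballI impI)
          fix i j assume ij: "i \<in> {..<?n}" "j \<in> {..<?n}" "i \<noteq> j"
          have "{X \<eta> i..Y \<eta> i} \<subseteq> {x (h i)<..<y (h i)}" "{X \<eta> j..Y \<eta> j} \<subseteq> {x (h j)<..<y (h j)}"
            using XY[of i] XY[of j] ij by auto
          moreover have "{x (h i)<..<y (h i)} \<inter> {x (h j)<..<y (h j)} = {}"
            using fam ij by (simp add: interval_family_def disjoint_family_on_def)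
          ultimately show "{X \<eta> i..Y \<eta> i} \<inter> {X \<eta> j..Y \<eta> j} = {}" by blast
        qed
      next
        have "(\<Sum>i<?n. Y \<eta> i - X \<eta> i) \<le> (\<Sum>i<?n. y (h i) - x (h i))"
          by (rule sum_mono) (use XY in force)
        then show "(\<Sum>i<?n. Y \<eta> i - X \<eta> i) < \<delta>" using less by simp
      qed
      then show ?thesis by simp
    qed
    have contF: "isCont F t" for t
      using cont by (simp add: continuous_on_eq_continuous_at)
    have "((\<lambda>\<eta>. \<Sum>i<?n. \<bar>F (Y \<eta> i) - F (X \<eta> i)\<bar>) \<longlongrightarrow> (\<Sum>i<?n. \<bar>F (y (h i)) - F (x (h i))\<bar>)) (at_right 0)"
      unfolding X_def Y_def
      by (intro tendsto_intros isCont_tendsto_compose[OF contF]) (auto intro!: tendsto_eq_intros)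
    moreover have "\<forall>\<^sub>F \<eta> in at_right 0. (\<Sum>i<?n. \<bar>F (Y \<eta> i) - F (X \<eta> i)\<bar>) \<le> \<epsilon> / 2"
      unfolding eventually_at_right[OF zero_less_one] using shrunk by (intro exI[of _ "1 / 2"]) auto
    ultimately have "(\<Sum>i<?n. \<bar>F (y (h i)) - F (x (h i))\<bar>) \<le> \<epsilon> / 2"
      by (rule tendsto_upperbound) simp
    moreover have "(\<Sum>i<?n. \<bar>F (y (h i)) - F (x (h i))\<bar>) = (\<Sum>i\<in>J. \<bar>F (y i) - F (x i)\<bar>)"
      using sum.reindex_bij_betw[OF h, of "\<lambda>i. \<bar>F (y i) - F (x i)\<bar>"] by (simp add: atLeast0LessThan)
    moreover have "\<dots> = (\<Sum>i\<in>I. \<bar>F (y i) - F (x i)\<bar>)"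
      using J fin eq by (intro sum.mono_neutral_left) auto
    ultimately show ?thesis using \<open>\<epsilon> > 0\<close> by simp
  qed
  then show "\<exists>\<delta>>0. \<forall>(I :: nat set) x y. interval_family a b I x y \<longrightarrow> (\<Sum>i\<in>I. y i - x i) < \<delta> \<longrightarrow>
      (\<Sum>i\<in>I. \<bar>F (y i) - F (x i)\<bar>) < \<epsilon>"
    using \<delta>(1) by blast
qed

section \<open>Arcs in real trees\<close>

locale real_tree_space =
  fixes T :: "'a::metric_space itself"
  assumes real_tree: "real_tree T"
begin

section \<open>Geodesics and the metric description of arcs\<close>

lemma geodesic_the_geodesic: "geodesic u v (the_geodesic u v :: real \<Rightarrow> 'a)"
proof -
  have "\<exists>!\<phi>. geodesic u v (\<phi> :: real \<Rightarrow> 'a)"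
    using real_tree unfolding real_tree_def by blast
  then show ?thesis unfolding the_geodesic_def by (rule theI')
qed

lemma the_geodesic_eqI: "geodesic u v \<phi> \<Longrightarrow> the_geodesic u v = (\<phi> :: real \<Rightarrow> 'a)"
  using real_tree geodesic_the_geodesic unfolding real_tree_def by blast

lemma dist_the_geodesic:
  "s \<in> {0..dist u v} \<Longrightarrow> t \<in> {0..dist u v} \<Longrightarrow>
    dist (the_geodesic u v s) (the_geodesic u v t :: 'a) = \<bar>s - t\<bar>"
  using geodesic_the_geodesic unfolding geodesic_def by blast

lemma the_geodesic_endpoints [simp]:
  "the_geodesic u v 0 = (u :: 'a)" "the_geodesic u v (dist u v) = (v :: 'a)"
  using geodesic_the_geodesic unfolding geodesic_def by blast+

lemma dist_the_geodesic_start: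
  "t \<in> {0..dist u v} \<Longrightarrow> dist u (the_geodesic u v t :: 'a) = t"
  using dist_the_geodesic[of 0 u v t] by simp

lemma dist_the_geodesic_end:
  "t \<in> {0..dist u v} \<Longrightarrow> dist (the_geodesic u v t :: 'a) v = dist u v - t"
  using dist_the_geodesic[of t u v "dist u v"] by simp

text \<open>For \<open>p\<close> before and \<open>q\<close> after \<open>z\<close>, the distance
  from \<open>p\<close> to \<open>q\<close> cannot be shorter than the way through \<open>z\<close>,
  for otherwise \<open>a\<close> and \<open>b\<close> would be closer than \<open>dist a b\<close>.
  So the concatenation is isometric.\<close>

lemma geodesic_concat:
  fixes a b z :: 'a
  assumes z: "dist a z + dist z b = dist a b"
  shows "geodesic a b (\<lambda>s. if s \<in> {0..dist a b} then
    if s \<le> dist a z then the_geodesic a z s else the_geodesic z b (s - dist a z) else undefined)"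
    (is "geodesic a b ?\<phi>")
proof -
  have le: "dist (?\<phi> s) (?\<phi> t) = t - s" if st: "0 \<le> s" "s \<le> t" "t \<le> dist a b" for s t
  proof -
    consider "t \<le> dist a z" | "dist a z < s" | "s \<le> dist a z" "dist a z < t" by linarith
    then show ?thesis
    proof cases
      case 1
      then show ?thesis using st z by (simp add: dist_the_geodesic)
    next
      case 2
      then show ?thesis using st z by (simp add: dist_the_geodesic)
    next
      case 3
      define p where "p = the_geodesic a z s"
      define q where "q = the_geodesic z b (t - dist a z)"
      have "dist a p = s" "dist p z = dist a z - s"
        using 3 st by (simp_all add: p_def dist_the_geodesic_start dist_the_geodesic_end)
      moreover have "dist z q = t - dist a z" "dist q b = dist z b - (t - dist a z)"
        using 3 st z by (simp_all add: q_def dist_the_geodesic_start dist_the_geodesic_end)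
      moreover have "dist p q \<le> dist p z + dist z q" "dist a b \<le> dist a p + dist p q + dist q b"
        using dist_triangle[of p q z] dist_triangle[of a b p] dist_triangle[of p b q] by auto
      ultimately have "dist p q = t - s" using z by linarith
      then show ?thesis using 3 st by (simp add: p_def q_def)
    qed
  qed
  have "dist (?\<phi> s) (?\<phi> t) = \<bar>s - t\<bar>" if "s \<in> {0..dist a b}" "t \<in> {0..dist a b}" for s t
    using le[of s t] le[of t s] that by (cases "s \<le> t") (simp_all add: dist_commute)
  moreover have "?\<phi> \<in> extensional {0..dist a b}" by (simp add: extensional_def)
  moreover have "?\<phi> (dist a b) = b"
  proof (cases "z = b")
    case False
    then have "dist a z < dist a b" using z by (simp add: dist_pos_lt flip: z)
    moreover have "dist a b - dist a z = dist z b" using z by simp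
    ultimately show ?thesis by simp
  qed simp
  ultimately show ?thesis by (auto simp: geodesic_def)
qed

text \<open>Uniqueness of geodesics enters here: the geodesic through \<open>z\<close> built by
  concatenation has to be the one defining the arc. From now on membership in arcs is linear
  arithmetic with distances.\<close>

lemma mem_tree_arc: "z \<in> tree_arc a b \<longleftrightarrow> dist a z + dist z b = dist a (b :: 'a)"
proof
  assume "z \<in> tree_arc a b"
  then show "dist a z + dist z b = dist a b"
    by (auto simp: tree_arc_def dist_the_geodesic_start dist_the_geodesic_end)
next
  assume z: "dist a z + dist z b = dist a b"
  then have le: "dist a z \<le> dist a b" using zero_le_dist[of z b] by linarith
  have eq: "the_geodesic a b (dist a z) = z"
    unfolding the_geodesic_eqI[OF geodesic_concat[OF z]] using le by simp
  then show "z \<in> tree_arc a b" unfolding tree_arc_def using le by (intro image_eqI[where x = "dist a z"]) (simp_all add: eq)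
qed

lemma tree_arc_commute: "tree_arc a b = tree_arc b (a :: 'a)"
  by (auto simp: mem_tree_arc dist_commute add.commute)

lemma tree_arc_ends [simp]: "a \<in> tree_arc a (b :: 'a)" "b \<in> tree_arc a b"
  by (auto simp: mem_tree_arc)

lemma tree_arc_refl [simp]: "tree_arc a a = {a :: 'a}"
  by (auto simp: mem_tree_arc dist_commute)

lemma the_geodesic_dist: "z \<in> tree_arc a b \<Longrightarrow> the_geodesic a b (dist a z) = (z :: 'a)"
  by (auto simp: tree_arc_def dist_the_geodesic_start)

lemma the_geodesic_mem: "t \<in> {0..dist a b} \<Longrightarrow> the_geodesic a b t \<in> tree_arc a (b :: 'a)"
  by (auto simp: tree_arc_def)

lemma dist_tree_arc_le: "z \<in> tree_arc a b \<Longrightarrow> dist a z \<le> dist a (b :: 'a)"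
  unfolding mem_tree_arc using zero_le_dist[of z b] by linarith

lemma dist_in_tree_arc:
  assumes "z \<in> tree_arc a b" "w \<in> tree_arc a (b :: 'a)"
  shows "dist z w = \<bar>dist a z - dist a w\<bar>"
  using dist_the_geodesic[of "dist a z" a b "dist a w"] assms
  by (simp add: the_geodesic_dist dist_tree_arc_le)

lemma tree_arc_subset: "z \<in> tree_arc a b \<Longrightarrow> tree_arc a z \<subseteq> tree_arc a (b :: 'a)"
proof
  fix w assume "z \<in> tree_arc a b" "w \<in> tree_arc a z"
  then show "w \<in> tree_arc a b"
    using dist_triangle[of w b z] dist_triangle[of a b w] by (simp add: mem_tree_arc)
qed

lemma tree_arc_initial:
  "z \<in> tree_arc a b \<Longrightarrow> tree_arc a z = {w \<in> tree_arc a b. dist a w \<le> dist a (z :: 'a)}"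
  using tree_arc_subset dist_tree_arc_le by (force simp: dist_in_tree_arc mem_tree_arc[of _ a z])

text \<open>Arcs inside [a,b] become intervals in the coordinate \<open>dist a\<close>; this is how
  sub-arcs are moved to the real line and back.\<close>

lemma tree_arc_between:
  fixes x y z :: 'a
  assumes x: "x \<in> tree_arc a b" and y: "y \<in> tree_arc a b" and le: "dist a x \<le> dist a y"
  shows "tree_arc x y = {z \<in> tree_arc a b. dist a z \<in> {dist a x..dist a y}}"
proof (intro set_eqI iffI)
  fix z assume z: "z \<in> tree_arc x y"
  have "x \<in> tree_arc y a"
    using x le tree_arc_initial[OF y] by (simp add: tree_arc_commute[of y a])
  then have "z \<in> tree_arc a y"
    using z tree_arc_subset[of x y a] by (auto simp: tree_arc_commute)
  then have "z \<in> tree_arc a b" and "dist a z + dist z y = dist a y"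
    using tree_arc_subset[OF y] by (auto simp: mem_tree_arc)
  moreover have "dist x z + dist z y = dist a y - dist a x"
    using z dist_in_tree_arc[OF x y] le by (simp add: mem_tree_arc)
  moreover from calculation have "dist a x \<le> dist a z" "dist a z \<le> dist a y"
    using zero_le_dist[of x z] zero_le_dist[of z y] by linarith+
  ultimately show "z \<in> {z \<in> tree_arc a b. dist a z \<in> {dist a x..dist a y}}"
    by simp
next
  fix z assume "z \<in> {z \<in> tree_arc a b. dist a z \<in> {dist a x..dist a y}}"
  then have z: "z \<in> tree_arc a b" "dist a x \<le> dist a z" "dist a z \<le> dist a y" by auto
  have "dist x z = dist a z - dist a x" "dist z y = dist a y - dist a z" "dist x y = dist a y - dist a x"
    using dist_in_tree_arc[OF x z(1)] dist_in_tree_arc[OF z(1) y] dist_in_tree_arc[OF x y] z(2,3) le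
    by simp_all
  then show "z \<in> tree_arc x y" by (simp add: mem_tree_arc)
qed

lemma continuous_on_the_geodesic: "continuous_on {0..dist a b} (the_geodesic a b :: real \<Rightarrow> 'a)"
  unfolding continuous_on_iff by (auto simp: dist_the_geodesic dist_real_def intro!: exI)

lemma compact_tree_arc: "compact (tree_arc a (b :: 'a))"
  unfolding tree_arc_def by (intro compact_continuous_image continuous_on_the_geodesic) simp

lemma closed_tree_arc: "closed (tree_arc a (b :: 'a))"
  by (rule compact_imp_closed[OF compact_tree_arc])

lemma tree_arc_parametrization:
  assumes "a \<noteq> (b :: 'a)"
  obtains \<gamma> where "arc \<gamma>" "pathstart \<gamma> = a" "pathfinish \<gamma> = b" "path_image \<gamma> = tree_arc a b"
proof
  let ?\<gamma> = "\<lambda>t. the_geodesic a b (dist a b * t)"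
  have pos: "dist a b > 0" using assms by simp
  have range: "dist a b * t \<in> {0..dist a b}" if "t \<in> {0..1}" for t
    using that pos by (auto simp: mult_left_le)
  have cont: "continuous_on {0..1} ?\<gamma>"
    by (rule continuous_on_compose2[OF continuous_on_the_geodesic])
      (use range in \<open>auto intro!: continuous_intros\<close>)
  moreover have "inj_on ?\<gamma> {0..1}"
  proof (rule inj_onI)
    fix s t assume st: "s \<in> {0..1}" "t \<in> {0..1}" "?\<gamma> s = ?\<gamma> t"
    then have "\<bar>dist a b * s - dist a b * t\<bar> = 0"
      using dist_the_geodesic[OF range[OF st(1)] range[OF st(2)]] by simp
    then show "s = t" using assms by simp
  qed
  ultimately show "arc ?\<gamma>" by (simp add: arc_def path_def)
  have "(\<lambda>t. dist a b * t) ` {0..1} = {0..dist a b}"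
    using pos image_mult_atLeastAtMost[of "dist a b" 0 1] by simp
  then show "path_image ?\<gamma> = tree_arc a b"
    unfolding path_image_def tree_arc_def by (metis image_image)
qed (simp_all add: pathstart_def pathfinish_def)

section \<open>Medians and branch points\<close>

text \<open>
  The point \<open>c\<close> where the arcs from \<open>r\<close> to \<open>a\<close> and to \<open>b\<close> separate makes \<open>[a,c] \<union> [c,b]\<close> the image
  of an injective path, which must then be \<open>[a,b]\<close>.
\<close>

lemma median_exists:
  fixes r a b :: 'a
  obtains c where "c \<in> tree_arc r a" "c \<in> tree_arc r b" "c \<in> tree_arc a b"
proof -
  have "compact (tree_arc r a \<inter> tree_arc r b)" "tree_arc r a \<inter> tree_arc r b \<noteq> {}"
    using compact_Int_closed[OF compact_tree_arc closed_tree_arc] tree_arc_ends by blast+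
  from continuous_attains_sup[OF this, of "dist r"] obtain c
    where c: "c \<in> tree_arc r a" "c \<in> tree_arc r b"
      and max: "\<And>z. z \<in> tree_arc r a \<Longrightarrow> z \<in> tree_arc r b \<Longrightarrow> dist r z \<le> dist r c"
    by (force intro: continuous_intros)
  have "c \<in> tree_arc a b"
  proof (cases "c = a \<or> c = b")
    case False
    \<comment> \<open>A point on both halves lies on [r,a] and [r,b]. Being on [a,c], it is farther
      from \<open>r\<close> than \<open>c\<close> by its distance to \<open>c\<close>, which
      contradicts the choice of \<open>c\<close> as the farthest common point unless the two
      coincide.\<close>
    have meet: "z = c" if "z \<in> tree_arc a c" "z \<in> tree_arc c b" for z
    proof -
      have "z \<in> tree_arc r a" "z \<in> tree_arc r b"
        using that c tree_arc_subset[of c a r] tree_arc_subset[of c b r] by (auto simp: tree_arc_commute)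
      with max have "dist r z \<le> dist r c" by blast
      moreover have "dist c z \<le> dist r z - dist r c"
        using that(1) c(1) dist_triangle[of r a z]
        by (simp add: mem_tree_arc dist_commute)
      ultimately have "dist c z \<le> 0" by linarith
      then show "z = c" by simp
    qed
    obtain \<gamma> where \<gamma>: "arc \<gamma>" "pathstart \<gamma> = a" "pathfinish \<gamma> = c" "path_image \<gamma> = tree_arc a c"
      using tree_arc_parametrization[of a c] False by metis
    obtain \<kappa> where \<kappa>: "arc \<kappa>" "pathstart \<kappa> = c" "pathfinish \<kappa> = b" "path_image \<kappa> = tree_arc c b"
      using tree_arc_parametrization[of c b] False by metis
    have "arc (\<gamma> +++ \<kappa>)"
      using \<gamma> \<kappa> meet by (intro arc_join) auto
    then have "path_image (\<gamma> +++ \<kappa>) = tree_arc a b"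
      using real_tree \<gamma> \<kappa> unfolding real_tree_def by (metis pathstart_join pathfinish_join)
    then show ?thesis
      using \<gamma> \<kappa> by (auto simp: path_image_join)
  qed auto
  with c that show thesis by blast
qed

text \<open>The median \<open>c\<close> splits [a,b] into [a,c] and [c,b], which lie on the arcs
  from \<open>r\<close> to \<open>a\<close> and to \<open>b\<close>. This reduces arbitrary arcs to
  arcs from the root.\<close>

lemma tree_arc_triangle: "tree_arc a b \<subseteq> tree_arc r a \<union> tree_arc r (b :: 'a)"
proof
  fix z assume z: "z \<in> tree_arc a b"
  obtain c where c: "c \<in> tree_arc r a" "c \<in> tree_arc r b" "c \<in> tree_arc a b"
    by (rule median_exists)
  show "z \<in> tree_arc r a \<union> tree_arc r b"
  proof (cases "dist a z \<le> dist a c")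
    case True
    then have "z \<in> tree_arc a c" using z tree_arc_initial[OF c(3)] by simp
    then show ?thesis using c(1) tree_arc_subset[of c a r] by (auto simp: tree_arc_commute)
  next
    case False
    then have "z \<in> tree_arc c b"
      using z c(3) dist_tree_arc_le[OF z] tree_arc_between[OF c(3), of b] dist_tree_arc_le[OF c(3)] by simp
    then show ?thesis using c(2) tree_arc_subset[of c b r] by (auto simp: tree_arc_commute)
  qed
qed

text \<open>A common point \<open>z\<close> farther from \<open>r\<close> than \<open>c\<close>
  would make the way from \<open>a\<close> to \<open>b\<close> through \<open>z\<close> shorter than
  the one through \<open>c\<close>, which already has length \<open>dist a b\<close>.\<close>

lemma tree_arc_Int:
  fixes r a b c :: 'a
  assumes c: "c \<in> tree_arc r a" "c \<in> tree_arc r b" "c \<in> tree_arc a b"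
  shows "tree_arc r a \<inter> tree_arc r b = tree_arc r c"
proof
  show "tree_arc r c \<subseteq> tree_arc r a \<inter> tree_arc r b"
    using tree_arc_subset c by blast
  show "tree_arc r a \<inter> tree_arc r b \<subseteq> tree_arc r c"
  proof
    fix z assume z: "z \<in> tree_arc r a \<inter> tree_arc r b"
    have "dist r z \<le> dist r c"
      using z c dist_triangle[of a b z] by (simp add: mem_tree_arc dist_commute)
    then show "z \<in> tree_arc r c"
      using z tree_arc_initial[OF c(1)] by simp
  qed
qed

lemma branch_point_eqI:
  fixes r a b c :: 'a
  assumes eq: "tree_arc r b \<inter> tree_arc r a = tree_arc r c"
  shows "branch_point r a b = c"
  unfolding branch_point_def
proof (rule the_equality)
  show "tree_arc r b \<inter> tree_arc r a = tree_arc r c" by (rule eq)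
  fix d assume "tree_arc r b \<inter> tree_arc r a = tree_arc r d"
  then have "c \<in> tree_arc r d" "d \<in> tree_arc r c" using eq tree_arc_ends by metis+
  then have "dist r c + dist c d = dist r d" "dist r d + dist c d = dist r c"
    by (simp_all add: mem_tree_arc dist_commute)
  then have "dist c d = 0" by linarith
  then show "d = c" by simp
qed

lemma branch_point_in_arcs:
  "branch_point r a b \<in> tree_arc r a" "branch_point r a b \<in> tree_arc r (b :: 'a)"
proof -
  obtain c where c: "c \<in> tree_arc r a" "c \<in> tree_arc r b" "c \<in> tree_arc a b"
    by (rule median_exists)
  have "branch_point r a b = c"
    using tree_arc_Int[OF c] by (intro branch_point_eqI) blast
  with c show "branch_point r a b \<in> tree_arc r a" "branch_point r a b \<in> tree_arc r b" by auto
qed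

lemma branch_point_on_arc: "x \<in> tree_arc r y \<Longrightarrow> branch_point r x y = (x :: 'a)"
  using tree_arc_subset by (intro branch_point_eqI) blast

lemma open_tree_arc_eq: "open_tree_arc a b = tree_arc a b - {a, b :: 'a}"
proof (intro set_eqI iffI)
  fix z assume "z \<in> open_tree_arc a b"
  then obtain t where t: "z = the_geodesic a b t" "0 < t" "t < dist a b"
    by (auto simp: open_tree_arc_def)
  then have "z \<in> tree_arc a b" "dist a z = t"
    by (auto simp: dist_the_geodesic_start intro!: the_geodesic_mem)
  then show "z \<in> tree_arc a b - {a, b}" using t by auto
next
  fix z assume z: "z \<in> tree_arc a b - {a, b}"
  then have "0 < dist a z" "0 < dist z b" "dist a z + dist z b = dist a b"
    by (auto simp: mem_tree_arc)
  then have "dist a z \<in> {0<..<dist a b}" unfolding greaterThanLessThan_iff by linarith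
  moreover have "z = the_geodesic a b (dist a z)" using z by (simp add: the_geodesic_dist)
  ultimately show "z \<in> open_tree_arc a b" unfolding open_tree_arc_def by blast
qed

lemma tree_arc_dist_inj:
  "z \<in> tree_arc a b \<Longrightarrow> w \<in> tree_arc a b \<Longrightarrow> dist a z = dist a w \<longleftrightarrow> z = (w :: 'a)"
  by (metis the_geodesic_dist)

lemma open_tree_arc_between:
  fixes x y :: 'a
  assumes x: "x \<in> tree_arc a b" and y: "y \<in> tree_arc a b" and le: "dist a x \<le> dist a y"
  shows "open_tree_arc x y = {z \<in> tree_arc a b. dist a z \<in> {dist a x<..<dist a y}}"
proof (intro set_eqI)
  fix z
  show "z \<in> open_tree_arc x y \<longleftrightarrow> z \<in> {z \<in> tree_arc a b. dist a z \<in> {dist a x<..<dist a y}}"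
    using tree_arc_dist_inj[of z a b x] tree_arc_dist_inj[of z a b y] x y
    unfolding open_tree_arc_eq tree_arc_between[OF assms] by auto
qed

end

section \<open>The length measure along arcs from the root\<close>

locale rooted_real_tree = real_tree_space T for T :: "'a::metric_space itself" +
  fixes L :: "'a measure" and \<rho> :: 'a
  assumes length_measure: "length_measure L"
begin

lemma sets_L [measurable_cong, simp]: "sets L = sets borel"
  using length_measure by (simp add: length_measure_def)

lemma space_L [simp]: "space L = UNIV"
  using sets_eq_imp_space_eq[OF sets_L] by simp

lemma measurable_L [simp]: "measurable L M = measurable borel M"
  by (rule measurable_cong_sets) simp_all

lemma tree_arc_sets [measurable, simp]: "tree_arc a (b :: 'a) \<in> sets borel"
  using closed_tree_arc by simp

lemma emeasure_open_tree_arc: "emeasure L (open_tree_arc a b) = ennreal (dist a b)"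
  using length_measure by (simp add: length_measure_def)

text \<open>A skeleton point \<open>x\<close> splits some ]a,b[ into ]a,x[, {x} and ]x,b[. The
  lengths of the two open arcs already add up to that of ]a,b[, so nothing is left for {x}. All
  other points lie in the null complement of the skeleton.\<close>

lemma singleton_null: "{x} \<in> null_sets L"
proof (cases "x \<in> skeleton")
  case False
  have "UNIV - skeleton \<in> null_sets L"
    using length_measure by (simp add: length_measure_def)
  then show ?thesis
    by (rule null_sets_subset) (use False in auto)
next
  case True
  then obtain a b where ab: "x \<in> open_tree_arc a b" by (auto simp: skeleton_def)
  then have x: "x \<in> tree_arc a b" "x \<noteq> a" "x \<noteq> b" and sum: "dist a x + dist x b = dist a b"
    by (auto simp: open_tree_arc_eq mem_tree_arc)
  have eq: "open_tree_arc a x = {z \<in> tree_arc a b. dist a z \<in> {0<..<dist a x}}"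
    "open_tree_arc x b = {z \<in> tree_arc a b. dist a z \<in> {dist a x<..<dist a b}}"
    "open_tree_arc a b = {z \<in> tree_arc a b. dist a z \<in> {0<..<dist a b}}"
    using x(1) dist_tree_arc_le[OF x(1)] open_tree_arc_between[of a a b]
      open_tree_arc_between[of x a b b] by simp_all
  have split: "open_tree_arc a b = (open_tree_arc a x \<union> open_tree_arc x b) \<union> {x}"
  proof (intro set_eqI)
    fix z
    show "z \<in> open_tree_arc a b \<longleftrightarrow> z \<in> (open_tree_arc a x \<union> open_tree_arc x b) \<union> {x}"
      using tree_arc_dist_inj[of z a b x] x(1) ab dist_tree_arc_le[OF x(1)]
      unfolding eq by (cases "z = x") auto
  qed
  have disj: "open_tree_arc a x \<inter> open_tree_arc x b = {}"
    "(open_tree_arc a x \<union> open_tree_arc x b) \<inter> {x} = {}"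
    unfolding eq by auto
  have meas: "open_tree_arc u v \<in> sets L" for u v
    by (simp add: open_tree_arc_eq)
  have "ennreal (dist a b) = emeasure L (open_tree_arc a x \<union> open_tree_arc x b) + emeasure L {x}"
    unfolding emeasure_open_tree_arc[symmetric] split
    using disj(2) meas by (intro plus_emeasure[symmetric]) auto
  also have "emeasure L (open_tree_arc a x \<union> open_tree_arc x b) = ennreal (dist a x) + ennreal (dist x b)"
    using disj(1) meas by (subst plus_emeasure[symmetric]) (auto simp: emeasure_open_tree_arc)
  also have "\<dots> = ennreal (dist a b)" by (simp flip: sum ennreal_plus)
  finally have "ennreal (dist a b) + 0 = ennreal (dist a b) + emeasure L {x}" by simp
  then have "emeasure L {x} = 0" by (metis ennreal_add_left_cancel ennreal_neq_top infinity_ennreal_def)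
  then show ?thesis by (simp add: null_sets_def)
qed

text \<open>Null endpoints carry the prescribed length of open arcs over to closed arcs and, with
  \<open>N\<close> a singleton, to half-open ones.\<close>

lemma emeasure_tree_arc_Diff:
  assumes "N \<in> null_sets L"
  shows "emeasure L (tree_arc a b - N) = ennreal (dist a b)"
proof -
  have ends: "{a, b} \<in> null_sets L"
    using null_sets.Un[OF singleton_null singleton_null, of a b] by (simp add: insert_commute)
  have "tree_arc a b = open_tree_arc a b \<union> {a, b}" by (auto simp: open_tree_arc_eq)
  moreover have "emeasure L (open_tree_arc a b \<union> {a, b}) = emeasure L (open_tree_arc a b)"
    by (rule emeasure_Un_null_set[OF _ ends]) (simp add: open_tree_arc_eq)
  ultimately have "emeasure L (tree_arc a b) = emeasure L (open_tree_arc a b)" by metis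
  then show ?thesis
    using emeasure_Diff_null_set[OF assms] by (simp add: emeasure_open_tree_arc)
qed

lemma emeasure_tree_arc: "emeasure L (tree_arc a b) = ennreal (dist a b)"
  using emeasure_tree_arc_Diff[of "{}"] by simp

lemma measurable_dist_root [measurable]: "dist \<rho> \<in> borel_measurable borel"
  by (intro borel_measurable_continuous_onI continuous_intros)

text \<open>Both measures are finite, so half-lines decide. For \<open>t\<close> between 0 and
  \<open>dist \<rho> y\<close>, the points of the arc farther than \<open>t\<close> from \<rho> form
  the half-open arc ]p,y], where \<open>p\<close> is at distance \<open>t\<close>; its length is
  \<open>dist \<rho> y - t\<close>.\<close>

lemma distr_tree_arc:
  "distr (density L (indicator (tree_arc \<rho> y))) borel (dist \<rho>) = density lborel (indicator {0..dist \<rho> y})"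
    (is "?M = ?N")
proof (rule measure_eqI_lessThan)
  fix t :: real
  have M: "emeasure ?M {t<..} = emeasure L (tree_arc \<rho> y \<inter> dist \<rho> -` {t<..})"
    using measurable_sets_borel[of "dist \<rho>" borel "{t<..}"]
    by (simp add: emeasure_distr emeasure_restricted vimage_def)
  have N: "emeasure ?N {t<..} = emeasure lborel ({0..dist \<rho> y} \<inter> {t<..})"
    by (simp add: emeasure_restricted)
  consider "t < 0" | "dist \<rho> y < t" | "0 \<le> t" "t \<le> dist \<rho> y" by linarith
  then show "emeasure ?M {t<..} = emeasure ?N {t<..}"
  proof cases
    case 1
    then have "tree_arc \<rho> y \<inter> dist \<rho> -` {t<..} = tree_arc \<rho> y" "{0..dist \<rho> y} \<inter> {t<..} = {0..dist \<rho> y}"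
      using less_le_trans[OF _ zero_le_dist] by auto
    then show ?thesis by (simp add: M N emeasure_tree_arc)
  next
    case 2
    then have "tree_arc \<rho> y \<inter> dist \<rho> -` {t<..} = {}" "{0..dist \<rho> y} \<inter> {t<..} = {}"
      using dist_tree_arc_le[of _ \<rho> y] by fastforce+
    then show ?thesis by (simp add: M N)
  next
    case 3
    define p where "p = the_geodesic \<rho> y t"
    have p: "p \<in> tree_arc \<rho> y" "dist \<rho> p = t" "dist p y = dist \<rho> y - t"
      using 3 by (auto simp: p_def dist_the_geodesic_start dist_the_geodesic_end intro!: the_geodesic_mem)
    have "tree_arc \<rho> y \<inter> dist \<rho> -` {t<..} = tree_arc p y - {p}"
    proof -
      have eq: "tree_arc p y = {z \<in> tree_arc \<rho> y. dist \<rho> z \<in> {t..dist \<rho> y}}"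
        using tree_arc_between[OF p(1), of y] p(2) 3 by simp
      show ?thesis
      proof (intro set_eqI)
        fix z
        show "z \<in> tree_arc \<rho> y \<inter> dist \<rho> -` {t<..} \<longleftrightarrow> z \<in> tree_arc p y - {p}"
          using tree_arc_dist_inj[of z \<rho> y p] p(1,2) dist_tree_arc_le[of z \<rho> y]
          unfolding eq by auto
      qed
    qed
    moreover have "{0..dist \<rho> y} \<inter> {t<..} = {t<..dist \<rho> y}" using 3 by auto
    ultimately show ?thesis
      using 3 by (simp add: M N emeasure_tree_arc_Diff[OF singleton_null] p(3))
  qed
  have "emeasure ?M {t<..} \<le> emeasure L (tree_arc \<rho> y)"
    unfolding M by (rule emeasure_mono) auto
  then show "emeasure ?M {t<..} < \<infinity>"
    by (simp add: emeasure_tree_arc order_le_less_trans)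
qed simp_all

lemma AE_tree_arcI:
  assumes "AE t in lborel. t \<in> {0..dist \<rho> y} \<longrightarrow> P t"
  shows "AE z in L. z \<in> tree_arc \<rho> y \<longrightarrow> P (dist \<rho> z)"
proof -
  have "AE t in density lborel (indicator {0..dist \<rho> y}). P t"
    using assms by (subst AE_density) (auto simp: indicator_def elim!: eventually_mono)
  then have "AE z in density L (indicator (tree_arc \<rho> y)). P (dist \<rho> z)"
    unfolding distr_tree_arc[symmetric] by (rule AE_distrD[rotated]) simp
  then show ?thesis
    by (subst (asm) AE_density) (auto simp: indicator_def elim!: eventually_mono)
qed

lemma
  fixes v :: "real \<Rightarrow> real"
  assumes [measurable]: "v \<in> borel_measurable borel" "B \<in> sets borel"
  shows set_integrable_tree_arc:
    "set_integrable L {z \<in> tree_arc \<rho> y. dist \<rho> z \<in> B} (\<lambda>z. v (dist \<rho> z)) \<longleftrightarrow>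
       set_integrable lborel ({0..dist \<rho> y} \<inter> B) v" (is ?integrable)
    and set_integral_tree_arc:
    "(LINT z:{z \<in> tree_arc \<rho> y. dist \<rho> z \<in> B}|L. v (dist \<rho> z)) =
       (LINT t:{0..dist \<rho> y} \<inter> B|lborel. v t)" (is ?integral)
proof -
  define u where "u t = indicat_real B t * v t" for t
  have [measurable]: "u \<in> borel_measurable borel" unfolding u_def by measurable
  have eq: "indicat_real {z \<in> tree_arc \<rho> y. dist \<rho> z \<in> B} z *\<^sub>R v (dist \<rho> z) =
      indicat_real (tree_arc \<rho> y) z *\<^sub>R u (dist \<rho> z)" for z
    by (simp add: u_def indicator_def)
  have eq': "indicat_real ({0..dist \<rho> y} \<inter> B) t *\<^sub>R v t = indicat_real {0..dist \<rho> y} t *\<^sub>R u t" for t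
    by (simp add: u_def indicator_def)
  \<comment> \<open>The transfer rules for integrals against a density expect it as a real function
    under \<open>ennreal\<close>.\<close>
  have ind: "(indicator A :: 'b \<Rightarrow> ennreal) = (\<lambda>x. ennreal (indicat_real A x))" for A :: "'b set"
    by (simp add: fun_eq_iff ennreal_indicator)
  note d = distr_tree_arc[of y, unfolded ind]
  have "set_integrable L {z \<in> tree_arc \<rho> y. dist \<rho> z \<in> B} (\<lambda>z. v (dist \<rho> z)) \<longleftrightarrow>
      integrable (distr (density L (\<lambda>z. ennreal (indicat_real (tree_arc \<rho> y) z))) borel (dist \<rho>)) u"
    unfolding set_integrable_def eq
    by (subst integrable_distr_eq) (auto simp: integrable_density)
  also have "\<dots> \<longleftrightarrow> set_integrable lborel ({0..dist \<rho> y} \<inter> B) v"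
    unfolding d set_integrable_def eq' by (subst integrable_density) auto
  finally show ?integrable .
  have "(LINT z:{z \<in> tree_arc \<rho> y. dist \<rho> z \<in> B}|L. v (dist \<rho> z)) =
      integral\<^sup>L (distr (density L (\<lambda>z. ennreal (indicat_real (tree_arc \<rho> y) z))) borel (dist \<rho>)) u"
    unfolding set_lebesgue_integral_def eq
    by (subst integral_distr) (auto simp: integral_density)
  also have "\<dots> = (LINT t:{0..dist \<rho> y} \<inter> B|lborel. v t)"
    unfolding d set_lebesgue_integral_def eq' by (subst integral_density) auto
  finally show ?integral .
qed

end

section \<open>Gluing densities along countably many arcs\<close>

text \<open>A strictly positive integrable density gives a finite measure \<open>N\<close> with the
  same null sets. Uniting a maximizing sequence of countable subfamilies yields one whose union has
  the largest \<open>N\<close>-measure; adding a further \<open>A\<close> cannot increase this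
  finite value.\<close>

lemma (in sigma_finite_measure) countable_exhaustion:
  assumes sets: "\<A> \<subseteq> sets M"
  obtains \<C> where "\<C> \<subseteq> \<A>" "countable \<C>" "\<And>A. A \<in> \<A> \<Longrightarrow> A - \<Union>\<C> \<in> null_sets M"
proof -
  obtain h where h[measurable]: "h \<in> borel_measurable M" and fin: "integral\<^sup>N M h \<noteq> \<infinity>"
    and pos: "\<And>x. x \<in> space M \<Longrightarrow> 0 < h x \<and> h x < \<infinity>"
    using Ex_finite_integrable_function by auto
  define N where "N = density M h"
  have [simp]: "sets N = sets M" "space N = space M" by (simp_all add: N_def)
  have finN: "emeasure N X \<noteq> \<infinity>" for X
  proof -
    have "emeasure N (space N) = integral\<^sup>N M h"
      by (simp add: N_def emeasure_density cong: nn_integral_cong)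
    then show ?thesis
      using fin emeasure_space[of N X] by (auto simp: top_unique)
  qed
  have null: "X \<in> null_sets M" if "X \<in> null_sets N" for X
  proof -
    have X: "X \<in> sets M" and AE: "AE x in M. x \<in> X \<longrightarrow> h x = 0"
      using that unfolding N_def by (simp_all add: null_sets_density_iff)
    have "AE x in M. x \<notin> X"
      using AE AE_space[of M] by eventually_elim (use pos in force)
    then show ?thesis using X by (simp add: AE_iff_null_sets)
  qed
  define F where "F = {\<C>. \<C> \<subseteq> \<A> \<and> countable \<C>}"
  have "F \<noteq> {}" by (auto simp: F_def)
  then obtain u :: "nat \<Rightarrow> ennreal" where u: "range u \<subseteq> (\<lambda>\<C>. emeasure N (\<Union>\<C>)) ` F"
    and Sup: "(SUP \<C>\<in>F. emeasure N (\<Union>\<C>)) = (SUP n. u n)"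
    using ennreal_SUP_countable_SUP[of F "\<lambda>\<C>. emeasure N (\<Union>\<C>)"] by auto
  have "\<forall>n. \<exists>\<C>\<in>F. u n = emeasure N (\<Union>\<C>)" using u by blast
  then obtain C where C: "\<And>n. C n \<in> F" "\<And>n. u n = emeasure N (\<Union>(C n))" by metis
  define D where "D = (\<Union>n. C n)"
  have D: "D \<in> F" using C(1) by (auto simp: D_def F_def)
  have meas: "\<Union>\<C> \<in> sets M" if "\<C> \<in> F" for \<C>
    using that sets by (intro sets.countable_Union) (auto simp: F_def)
  have max: "emeasure N (\<Union>\<C>) \<le> emeasure N (\<Union>D)" if "\<C> \<in> F" for \<C>
  proof -
    have "emeasure N (\<Union>\<C>) \<le> (SUP n. u n)"
      unfolding Sup[symmetric] using that by (rule SUP_upper)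
    also have "\<dots> \<le> emeasure N (\<Union>D)"
      unfolding C(2) using meas[OF D] by (intro SUP_least emeasure_mono) (auto simp: D_def)
    finally show ?thesis .
  qed
  show thesis
  proof (rule that[of D])
    show "D \<subseteq> \<A>" "countable D" using D by (auto simp: F_def)
    fix A assume "A \<in> \<A>"
    then have F: "insert A D \<in> F" using D by (auto simp: F_def)
    have A: "A \<in> sets M" using sets \<open>A \<in> \<A>\<close> by blast
    have "emeasure N (\<Union>D) + emeasure N (A - \<Union>D) = emeasure N (\<Union>(insert A D))"
      using meas[OF D] A by (subst plus_emeasure) (auto intro!: arg_cong[where f = "emeasure N"])
    also have "\<dots> \<le> emeasure N (\<Union>D) + 0" using max[OF F] by simp
    finally have "emeasure N (A - \<Union>D) = 0"
      using finN by (subst (asm) ennreal_add_left_cancel_le) auto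
    then show "A - \<Union>D \<in> null_sets M"
      using meas[OF D] A by (intro null) (auto simp: null_sets_def)
  qed
qed

context rooted_real_tree
begin

lemma sigma_finite_L: "sigma_finite_measure L"
  using length_measure by (simp add: length_measure_def)

lemma countable_arc_cover:
  obtains y :: "nat \<Rightarrow> 'a" where "\<And>x. tree_arc \<rho> x - (\<Union>n. tree_arc \<rho> (y n)) \<in> null_sets L"
    "- (\<Union>n. tree_arc \<rho> (y n)) \<in> null_sets L"
proof -
  obtain \<C> where \<C>: "\<C> \<subseteq> range (tree_arc \<rho>)" "countable \<C>"
    "\<And>A. A \<in> range (tree_arc \<rho>) \<Longrightarrow> A - \<Union>\<C> \<in> null_sets L"
    using sigma_finite_measure.countable_exhaustion[OF sigma_finite_L, of "range (tree_arc \<rho>)"]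
    by (metis (no_types, lifting) image_subsetI sets_L tree_arc_sets)
  then obtain Y where Y: "countable Y" "\<C> = tree_arc \<rho> ` Y"
    by (metis countable_subset_image)
  \<comment> \<open>Inserting \<rho> makes the set nonempty, as enumeration by all naturals
    requires; it adds only the arc {\<rho>}.\<close>
  define y where "y = from_nat_into (insert \<rho> Y)"
  define U where "U = (\<Union>n. tree_arc \<rho> (y n))"
  have "range y = insert \<rho> Y"
    unfolding y_def using Y(1) by (intro range_from_nat_into) auto
  then have sub: "\<Union>\<C> \<subseteq> U" unfolding U_def Y(2) by (force simp: image_iff)
  have U: "U \<in> sets borel" unfolding U_def by simp
  have null: "tree_arc \<rho> x - U \<in> null_sets L" for x
    using \<C>(3)[of "tree_arc \<rho> x"] sub U by (rule_tac null_sets_subset) auto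
  \<comment> \<open>If \<open>z\<close> were outside \<open>U\<close>, so would be all of [z,a],
    because an arc from \<rho> that reaches a point of [z,a] passes through \<open>z\<close>. Then
    [z,a] would be null despite its positive length. The end \<open>a\<close> is excluded, as it may
    be a leaf outside \<open>U\<close>.\<close>
  have "z \<in> U" if z: "z \<in> tree_arc \<rho> a" "z \<noteq> a" for z a
  proof (rule ccontr)
    assume "z \<notin> U"
    have za: "tree_arc z a = {w \<in> tree_arc \<rho> a. dist \<rho> w \<in> {dist \<rho> z..dist \<rho> a}}"
      by (rule tree_arc_between[OF z(1)]) (simp_all add: dist_tree_arc_le z)
    have "w \<notin> U" if "w \<in> tree_arc z a" for w
    proof
      assume "w \<in> U"
      then obtain n where n: "w \<in> tree_arc \<rho> (y n)" by (auto simp: U_def)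
      have "w \<in> tree_arc \<rho> a" "dist \<rho> z \<le> dist \<rho> w" using that za by auto
      then have "z \<in> tree_arc \<rho> w" using z(1) tree_arc_initial[of w \<rho> a] by simp
      then have "z \<in> U" using tree_arc_subset[OF n] by (auto simp: U_def)
      then show False using \<open>z \<notin> U\<close> by contradiction
    qed
    then have "tree_arc z a \<subseteq> tree_arc \<rho> a - U" using za by auto
    then have "tree_arc z a \<in> null_sets L"
      by (intro null_sets_subset[OF null]) auto
    then have "dist z a = 0" using emeasure_tree_arc[of z a] by (simp add: null_sets_def)
    then show False using z(2) by simp
  qed
  then have "open_tree_arc a b \<subseteq> U" for a b
    using tree_arc_triangle[of a b \<rho>] unfolding open_tree_arc_eq by blast
  then have "- U \<subseteq> UNIV - skeleton" by (auto simp: skeleton_def)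
  moreover have "UNIV - skeleton \<in> null_sets L"
    using length_measure by (simp add: length_measure_def)
  ultimately have "- U \<in> null_sets L"
    using U by (intro null_sets_subset[of _ L "- U"]) auto
  with null show thesis unfolding U_def by (rule that)
qed

section \<open>Uniqueness along arcs from the root\<close>

lemma tree_integral_on_arc:
  assumes "x \<in> tree_arc \<rho> y"
  shows "tree_integral \<rho> L x y g = (LINT z:tree_arc x y|L. g z)"
proof -
  \<comment> \<open>The branch point is \<open>x\<close> itself, so the first integral runs over a
    single point.\<close>
  have "AE z in L. z \<notin> {x}" using singleton_null by (rule AE_not_in)
  then have "(LINT z:{x}|L. g z) = 0"
    unfolding set_lebesgue_integral_def by (intro integral_eq_zero_AE) (auto elim!: eventually_mono)
  then show ?thesis
    by (simp add: tree_integral_def branch_point_on_arc[OF assms])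
qed

lemma AE_eq_of_arc_integrals:
  assumes g: "g \<in> L1_loc L" and h: "h \<in> L1_loc L"
    and eq: "\<And>x y. x \<in> tree_arc \<rho> y \<Longrightarrow> (LINT z:tree_arc x y|L. g z) = (LINT z:tree_arc x y|L. h z)"
  shows "AE z in L. h z = g z"
proof -
  define k where "k z = g z - h z" for z
  have [measurable]: "g \<in> borel_measurable borel" "h \<in> borel_measurable borel"
    using g h by (auto simp: L1_loc_def)
  have int: "set_integrable L (tree_arc a b) g" "set_integrable L (tree_arc a b) h" for a b
    using g h by (auto simp: L1_loc_def)
  have k: "set_integrable L (tree_arc a b) k" for a b
    unfolding k_def using int by (rule set_integral_diff)
  have k0: "(LINT z:tree_arc x y|L. k z) = 0" if "x \<in> tree_arc \<rho> y" for x y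
    unfolding k_def using set_integral_diff(2)[OF int] eq[OF that] by simp
  have arc: "AE z in L. z \<in> tree_arc \<rho> y \<longrightarrow> k z = 0" for y
  proof -
    let ?l = "dist \<rho> y"
    \<comment> \<open>The geodesic is specified on [0,?l] only; clamping makes it continuous, hence
      Borel, on the whole line.\<close>
    define \<phi> where "\<phi> t = the_geodesic \<rho> y (max 0 (min ?l t))" for t
    have "continuous_on UNIV \<phi>"
      unfolding \<phi>_def
      by (rule continuous_on_compose2[OF continuous_on_the_geodesic]) (auto intro!: continuous_intros)
    then have [measurable]: "\<phi> \<in> borel_measurable borel"
      by (rule borel_measurable_continuous_onI)
    define v where "v t = k (\<phi> t)" for t
    have v[measurable]: "v \<in> borel_measurable borel" unfolding v_def k_def by measurable
    have vk: "v (dist \<rho> z) = k z" if "z \<in> tree_arc \<rho> y" for z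
      using that dist_tree_arc_le[OF that] by (simp add: v_def \<phi>_def the_geodesic_dist)
    have cong: "indicat_real {z \<in> tree_arc \<rho> y. dist \<rho> z \<in> B} z *\<^sub>R v (dist \<rho> z) =
        indicat_real {z \<in> tree_arc \<rho> y. dist \<rho> z \<in> B} z *\<^sub>R k z" for B z
      by (simp add: vk indicator_def)
    have "set_integrable L {z \<in> tree_arc \<rho> y. dist \<rho> z \<in> UNIV} (\<lambda>z. v (dist \<rho> z))"
      unfolding set_integrable_def cong using k[of \<rho> y] by (simp add: set_integrable_def)
    then have "set_integrable lborel ({0..?l} \<inter> UNIV) v"
      by (subst (asm) set_integrable_tree_arc) simp_all
    moreover have "(LINT t:{s..t}|lborel. v t) = 0" if st: "0 \<le> s" "s \<le> t" "t \<le> ?l" for s t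
    proof -
      define p q where "p = the_geodesic \<rho> y s" and "q = the_geodesic \<rho> y t"
      have pq: "p \<in> tree_arc \<rho> y" "q \<in> tree_arc \<rho> y" "dist \<rho> p = s" "dist \<rho> q = t"
        using st by (auto simp: p_def q_def dist_the_geodesic_start intro!: the_geodesic_mem)
      have arc: "tree_arc p q = {z \<in> tree_arc \<rho> y. dist \<rho> z \<in> {s..t}}"
        using tree_arc_between[OF pq(1,2)] pq(3,4) st by simp
      have "p \<in> tree_arc \<rho> q" using pq st tree_arc_initial[OF pq(2)] by simp
      from k0[OF this] have "(LINT z:{z \<in> tree_arc \<rho> y. dist \<rho> z \<in> {s..t}}|L. v (dist \<rho> z)) = 0"
        unfolding arc set_lebesgue_integral_def cong .
      then have "(LINT t:{0..?l} \<inter> {s..t}|lborel. v t) = 0"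
        by (subst (asm) set_integral_tree_arc) simp_all
      moreover have "{0..?l} \<inter> {s..t} = {s..t}" using st by auto
      ultimately show ?thesis by metis
    qed
    ultimately have "AE t in lborel. t \<in> {0..?l} \<longrightarrow> v t = 0"
      by (intro set_integral_intervals_zero_AE) simp_all
    from AE_tree_arcI[OF this] show ?thesis
      by eventually_elim (simp add: vk)
  qed
  \<comment> \<open>Each arc has its own exceptional set; countably many arcs covering almost
    everything keep their union null.\<close>
  obtain y :: "nat \<Rightarrow> 'a" where "- (\<Union>n. tree_arc \<rho> (y n)) \<in> null_sets L"
    by (rule countable_arc_cover)
  then have "AE z in L. z \<notin> - (\<Union>n. tree_arc \<rho> (y n))" by (rule AE_not_in)
  moreover have "AE z in L. \<forall>n. z \<in> tree_arc \<rho> (y n) \<longrightarrow> k z = 0"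
    unfolding AE_all_countable using arc by blast
  ultimately show ?thesis
    by eventually_elim (auto simp: k_def)
qed

text \<open>Take \<open>S\<close> to be [\<rho>,y], whose length is finite. The geodesic turns
  disjoint closed intervals into disjoint arcs inside \<open>S\<close> of the same lengths.\<close>

lemma abs_continuous_on_geodesic:
  assumes f: "locally_absolutely_continuous L f"
  shows "abs_continuous_on 0 (dist \<rho> y) (\<lambda>t. f (the_geodesic \<rho> y (max 0 (min (dist \<rho> y) t))))"
    (is "abs_continuous_on 0 ?l (\<lambda>t. f (?\<phi> t))")
proof (rule abs_continuous_on_disjointI)
  have "continuous_on UNIV f" using f by (simp add: locally_absolutely_continuous_def)
  moreover have "continuous_on UNIV ?\<phi>"
    by (rule continuous_on_compose2[OF continuous_on_the_geodesic]) (auto intro!: continuous_intros)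
  ultimately show "continuous_on UNIV (\<lambda>t. f (?\<phi> t))"
    by (rule continuous_on_compose2) auto
next
  fix \<epsilon> :: real assume "\<epsilon> > 0"
  have arc: "tree_arc \<rho> y \<in> sets L" "emeasure L (tree_arc \<rho> y) < \<infinity>"
    by (simp_all add: emeasure_tree_arc)
  note f[unfolded locally_absolutely_continuous_def, THEN conjunct2, rule_format, OF \<open>\<epsilon> > 0\<close> arc]
  then obtain \<delta> where \<delta>: "\<delta> > 0" "\<And>(n :: nat) x z.
      disjoint_family_on (\<lambda>i. tree_arc (x i) (z i)) {..<n} \<Longrightarrow>
      (\<And>i. i < n \<Longrightarrow> tree_arc (x i) (z i) \<subseteq> tree_arc \<rho> y) \<Longrightarrow>
      (\<Sum>i<n. dist (x i) (z i)) < \<delta> \<Longrightarrow> (\<Sum>i<n. \<bar>f (x i) - f (z i)\<bar>) < \<epsilon>"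
    by blast
  show "\<exists>\<delta>>0. \<forall>(n :: nat) s t. (\<forall>i<n. 0 \<le> s i \<and> s i \<le> t i \<and> t i \<le> ?l) \<longrightarrow>
      disjoint_family_on (\<lambda>i. {s i..t i}) {..<n} \<longrightarrow>
      (\<Sum>i<n. t i - s i) < \<delta> \<longrightarrow> (\<Sum>i<n. \<bar>f (?\<phi> (t i)) - f (?\<phi> (s i))\<bar>) < \<epsilon>"
  proof (intro exI[of _ \<delta>] conjI allI impI)
    fix n :: nat and s t
    assume st: "\<forall>i<n. 0 \<le> s i \<and> s i \<le> t i \<and> t i \<le> ?l"
      and disj: "disjoint_family_on (\<lambda>i. {s i..t i}) {..<n}" and less: "(\<Sum>i<n. t i - s i) < \<delta>"
    have \<phi>: "?\<phi> (s i) \<in> tree_arc \<rho> y" "?\<phi> (t i) \<in> tree_arc \<rho> y"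
      "dist \<rho> (?\<phi> (s i)) = s i" "dist \<rho> (?\<phi> (t i)) = t i" if "i < n" for i
      using st that by (auto simp: dist_the_geodesic_start intro!: the_geodesic_mem)
    have arc: "tree_arc (?\<phi> (s i)) (?\<phi> (t i)) = {z \<in> tree_arc \<rho> y. dist \<rho> z \<in> {s i..t i}}" if "i < n" for i
      using tree_arc_between[OF \<phi>(1,2)[OF that]] \<phi>(3,4)[OF that] st that by simp
    have "(\<Sum>i<n. \<bar>f (?\<phi> (s i)) - f (?\<phi> (t i))\<bar>) < \<epsilon>"
    proof (rule \<delta>(2))
      show "disjoint_family_on (\<lambda>i. tree_arc (?\<phi> (s i)) (?\<phi> (t i))) {..<n}"
        unfolding disjoint_family_on_def
      proof (intro ballI impI)
        fix i j assume ij: "i \<in> {..<n}" "j \<in> {..<n}" "i \<noteq> j"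
        then have "{s i..t i} \<inter> {s j..t j} = {}"
          using disj unfolding disjoint_family_on_def by blast
        then show "tree_arc (?\<phi> (s i)) (?\<phi> (t i)) \<inter> tree_arc (?\<phi> (s j)) (?\<phi> (t j)) = {}"
          using ij arc[of i] arc[of j] by blast
      qed
      show "tree_arc (?\<phi> (s i)) (?\<phi> (t i)) \<subseteq> tree_arc \<rho> y" if "i < n" for i
        using arc[OF that] by auto
      have "(\<Sum>i<n. dist (?\<phi> (s i)) (?\<phi> (t i))) = (\<Sum>i<n. t i - s i)"
      proof (rule sum.cong)
        fix i assume "i \<in> {..<n}"
        then show "dist (?\<phi> (s i)) (?\<phi> (t i)) = t i - s i"
          using dist_in_tree_arc[OF \<phi>(1,2)] \<phi>(3,4) st by simp
      qed simp
      then show "(\<Sum>i<n. dist (?\<phi> (s i)) (?\<phi> (t i))) < \<delta>" using less by simp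
    qed
    then show "(\<Sum>i<n. \<bar>f (?\<phi> (t i)) - f (?\<phi> (s i))\<bar>) < \<epsilon>"
      by (simp add: abs_minus_commute)
  qed (rule \<delta>(1))
qed

section \<open>Existence of the density on the tree\<close>

lemma radial_density:
  assumes "locally_absolutely_continuous L f"
  obtains G :: "real \<Rightarrow> real" where "G \<in> borel_measurable borel" "set_integrable lborel {0..dist \<rho> y} G"
    "\<And>s t. 0 \<le> s \<Longrightarrow> s \<le> t \<Longrightarrow> t \<le> dist \<rho> y \<Longrightarrow>
       f (the_geodesic \<rho> y t) - f (the_geodesic \<rho> y s) = (LINT u:{s..t}|lborel. G u)"
proof -
  obtain G :: "real \<Rightarrow> real" where G: "G \<in> borel_measurable borel" "set_integrable lborel {0..dist \<rho> y} G"
    "\<And>s t. 0 \<le> s \<Longrightarrow> s \<le> t \<Longrightarrow> t \<le> dist \<rho> y \<Longrightarrow>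
       f (the_geodesic \<rho> y (max 0 (min (dist \<rho> y) t))) - f (the_geodesic \<rho> y (max 0 (min (dist \<rho> y) s)))
         = (LINT u:{s..t}|lborel. G u)"
    by (rule abs_continuous_on_density[OF abs_continuous_on_geodesic[OF assms, of y] zero_le_dist]) blast
  show thesis
  proof (rule that[OF G(1,2)])
    fix s t assume "0 \<le> s" "s \<le> t" "t \<le> dist \<rho> y"
    then show "f (the_geodesic \<rho> y t) - f (the_geodesic \<rho> y s) = (LINT u:{s..t}|lborel. G u)"
      using G(3)[of s t] by simp
  qed
qed

text \<open>Lets the increments of \<open>f\<close> along two arcs from the root be compared up to
  their branch point.\<close>

lemma the_geodesic_initial:
  assumes "c \<in> tree_arc \<rho> x" "t \<in> {0..dist \<rho> c}"
  shows "the_geodesic \<rho> x t = the_geodesic \<rho> c t"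
proof -
  let ?z = "the_geodesic \<rho> c t"
  have "?z \<in> tree_arc \<rho> x"
    using the_geodesic_mem[OF assms(2)] tree_arc_subset[OF assms(1)] by blast
  moreover have "dist \<rho> ?z = t" using assms(2) by (rule dist_the_geodesic_start)
  ultimately show ?thesis using the_geodesic_dist by metis
qed

lemma density_exists:
  assumes f: "locally_absolutely_continuous L f"
  obtains g where "g \<in> L1_loc L" "\<And>x y. x \<in> tree_arc \<rho> y \<Longrightarrow> f y - f x = (LINT z:tree_arc x y|L. g z)"
proof -
  have "\<forall>y. \<exists>G :: real \<Rightarrow> real. G \<in> borel_measurable borel \<and> set_integrable lborel {0..dist \<rho> y} G \<and>
    (\<forall>s t. 0 \<le> s \<longrightarrow> s \<le> t \<longrightarrow> t \<le> dist \<rho> y \<longrightarrow>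
       f (the_geodesic \<rho> y t) - f (the_geodesic \<rho> y s) = (LINT u:{s..t}|lborel. G u))"
    using radial_density[OF f] by metis
  then obtain G :: "'a \<Rightarrow> real \<Rightarrow> real" where G[measurable]: "\<And>y. G y \<in> borel_measurable borel"
    and Gint: "\<And>y. set_integrable lborel {0..dist \<rho> y} (G y)"
    and Gf: "\<And>y s t. 0 \<le> s \<Longrightarrow> s \<le> t \<Longrightarrow> t \<le> dist \<rho> y \<Longrightarrow>
       f (the_geodesic \<rho> y t) - f (the_geodesic \<rho> y s) = (LINT u:{s..t}|lborel. G y u)"
    by metis
  have compat: "AE z in L. z \<in> tree_arc \<rho> x \<and> z \<in> tree_arc \<rho> y \<longrightarrow> G x (dist \<rho> z) = G y (dist \<rho> z)" for x y
  proof -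
    obtain c where c: "c \<in> tree_arc \<rho> x" "c \<in> tree_arc \<rho> y" "c \<in> tree_arc x y"
      by (rule median_exists)
    have le: "dist \<rho> c \<le> dist \<rho> x" "dist \<rho> c \<le> dist \<rho> y"
      using c by (simp_all add: dist_tree_arc_le)
    have int: "set_integrable lborel {s..t} (G x)" "set_integrable lborel {s..t} (G y)"
      if "0 \<le> s" "t \<le> dist \<rho> c" for s t
      using that le by (auto intro!: set_integrable_subset[OF Gint])
    have "AE t in lborel. t \<in> {0..dist \<rho> c} \<longrightarrow> G x t - G y t = 0"
    proof (rule set_integral_intervals_zero_AE)
      show "set_integrable lborel {0..dist \<rho> c} (\<lambda>t. G x t - G y t)"
        by (intro set_integral_diff int) simp_all
      fix s t assume st: "0 \<le> s" "s \<le> t" "t \<le> dist \<rho> c"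
      have "(LINT u:{s..t}|lborel. G x u - G y u) = (LINT u:{s..t}|lborel. G x u) - (LINT u:{s..t}|lborel. G y u)"
        using int st by (intro set_integral_diff) simp_all
      also have "\<dots> = (f (the_geodesic \<rho> x t) - f (the_geodesic \<rho> x s)) - (f (the_geodesic \<rho> y t) - f (the_geodesic \<rho> y s))"
        using st le by (simp add: Gf)
      also have "\<dots> = 0"
        using st by (simp add: the_geodesic_initial[OF c(1)] the_geodesic_initial[OF c(2)])
      finally show "(LINT u:{s..t}|lborel. G x u - G y u) = 0" .
    qed
    from AE_tree_arcI[OF this] show ?thesis
      by eventually_elim (use tree_arc_Int[OF c] in auto)
  qed
  obtain y :: "nat \<Rightarrow> 'a" where cover: "\<And>x. tree_arc \<rho> x - (\<Union>n. tree_arc \<rho> (y n)) \<in> null_sets L"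
    by (rule countable_arc_cover) blast
  \<comment> \<open>The first covering arc containing \<open>z\<close> selects the density used at
    \<open>z\<close>, in a measurable way. Off the cover the choice is arbitrary, but only a null
    part of each [\<rho>,x] lies there.\<close>
  define N where "N z = (LEAST n. z \<in> tree_arc \<rho> (y n))" for z
  define g where "g z = G (y (N z)) (dist \<rho> z)" for z
  have [measurable]: "N \<in> measurable borel (count_space UNIV)"
    unfolding N_def by measurable
  have g[measurable]: "g \<in> borel_measurable borel"
    unfolding g_def by (rule measurable_compose_countable[where f = "\<lambda>n z. G (y n) (dist \<rho> z)"]) measurable
  have gG: "AE z in L. z \<in> tree_arc \<rho> x \<longrightarrow> g z = G x (dist \<rho> z)" for x
  proof -
    have "AE z in L. \<forall>n. z \<in> tree_arc \<rho> x \<and> z \<in> tree_arc \<rho> (y n) \<longrightarrow> G x (dist \<rho> z) = G (y n) (dist \<rho> z)"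
      unfolding AE_all_countable using compat by blast
    moreover have "AE z in L. z \<notin> tree_arc \<rho> x - (\<Union>n. tree_arc \<rho> (y n))"
      using cover by (rule AE_not_in)
    ultimately show ?thesis
    proof eventually_elim
      fix z
      assume eq: "\<forall>n. z \<in> tree_arc \<rho> x \<and> z \<in> tree_arc \<rho> (y n) \<longrightarrow> G x (dist \<rho> z) = G (y n) (dist \<rho> z)"
        and nin: "z \<notin> tree_arc \<rho> x - (\<Union>n. tree_arc \<rho> (y n))"
      show "z \<in> tree_arc \<rho> x \<longrightarrow> g z = G x (dist \<rho> z)"
      proof
        assume z: "z \<in> tree_arc \<rho> x"
        with nin have "\<exists>n. z \<in> tree_arc \<rho> (y n)" by blast
        then have "z \<in> tree_arc \<rho> (y (N z))" unfolding N_def by (rule LeastI_ex)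
        with eq z show "g z = G x (dist \<rho> z)" by (simp add: g_def)
      qed
    qed
  qed
  have cong: "AE z in L. indicat_real {z \<in> tree_arc \<rho> y. dist \<rho> z \<in> B} z *\<^sub>R g z =
      indicat_real {z \<in> tree_arc \<rho> y. dist \<rho> z \<in> B} z *\<^sub>R G y (dist \<rho> z)" for y B
    using gG[of y] by eventually_elim (simp add: indicator_def)
  have meas: "{z \<in> tree_arc \<rho> y. dist \<rho> z \<in> B} \<in> sets borel" if [measurable]: "B \<in> sets borel" for y B
    by measurable
  have int_root: "set_integrable L (tree_arc \<rho> y) g" for y
  proof -
    have "set_integrable L {z \<in> tree_arc \<rho> y. dist \<rho> z \<in> UNIV} (\<lambda>z. G y (dist \<rho> z))"
      using Gint by (subst set_integrable_tree_arc) simp_all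
    then have "set_integrable L {z \<in> tree_arc \<rho> y. dist \<rho> z \<in> UNIV} g"
      unfolding set_integrable_def
      using integrable_cong_AE[OF _ _ cong] meas by (simp del: UNIV_I)
    then show ?thesis by simp
  qed
  have "g \<in> L1_loc L"
    unfolding L1_loc_def
  proof (intro CollectI conjI g allI)
    fix a b
    have "set_integrable L (tree_arc \<rho> a \<union> tree_arc \<rho> b) g"
      by (intro set_integrable_Un int_root) simp_all
    then show "set_integrable L (tree_arc a b) g"
      by (rule set_integrable_subset) (use tree_arc_triangle in auto)
  qed
  moreover have "f y - f x = (LINT z:tree_arc x y|L. g z)" if x: "x \<in> tree_arc \<rho> y" for x y
  proof -
    let ?B = "{dist \<rho> x..dist \<rho> y}"
    have le: "dist \<rho> x \<le> dist \<rho> y" by (rule dist_tree_arc_le[OF x])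
    have "(LINT z:tree_arc x y|L. g z) = (LINT z:{z \<in> tree_arc \<rho> y. dist \<rho> z \<in> ?B}|L. g z)"
      using tree_arc_between[OF x tree_arc_ends(2) le] by simp
    also have "\<dots> = (LINT z:{z \<in> tree_arc \<rho> y. dist \<rho> z \<in> ?B}|L. G y (dist \<rho> z))"
      unfolding set_lebesgue_integral_def
      by (rule integral_cong_AE[OF _ _ cong]) (use meas in simp_all)
    also have "\<dots> = (LINT t:{0..dist \<rho> y} \<inter> ?B|lborel. G y t)"
      by (rule set_integral_tree_arc) simp_all
    also have "{0..dist \<rho> y} \<inter> ?B = ?B" by auto
    also have "(LINT t:?B|lborel. G y t) = f (the_geodesic \<rho> y (dist \<rho> y)) - f (the_geodesic \<rho> y (dist \<rho> x))"
      using le by (intro Gf[symmetric]) simp_all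
    also have "\<dots> = f y - f x" using x by (simp add: the_geodesic_dist)
    finally show ?thesis ..
  qed
  ultimately show thesis by (rule that)
qed

end

theorem proposition1p1:
  fixes \<rho> :: "'a::metric_space" and L :: "'a measure" and f :: "'a \<Rightarrow> real"
  assumes "real_tree TYPE('a)"
    and "locally compact (UNIV :: 'a set)"
    and "length_measure L"
    and "locally_absolutely_continuous L f"
  shows "(\<exists>g\<in>L1_loc L.
            (\<forall>x y. f y - f x = tree_integral \<rho> L x y g) \<and>
            (\<forall>h\<in>L1_loc L. (\<forall>x y. f y - f x = tree_integral \<rho> L x y h) \<longrightarrow>
               (AE z in L. h z = g z))) \<and>
         (\<forall>g\<in>L1_loc L. \<forall>h\<in>L1_loc L.
            (\<forall>y. \<forall>x\<in>tree_arc \<rho> y. f y - f x = tree_integral \<rho> L x y g) \<longrightarrow>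
            (\<forall>y. \<forall>x\<in>tree_arc \<rho> y. f y - f x = tree_integral \<rho> L x y h) \<longrightarrow>
            (AE z in L. h z = g z))"
proof -
  interpret rooted_real_tree "TYPE('a)" L \<rho>
    using assms(1,3) by unfold_locales
  \<comment> \<open>The identity for all \<open>x\<close>, \<open>y\<close> includes these
    instances, so this serves both uniqueness claims.\<close>
  have unique: "AE z in L. h z = g z"
    if "g \<in> L1_loc L" "h \<in> L1_loc L"
      "\<forall>y. \<forall>x\<in>tree_arc \<rho> y. f y - f x = tree_integral \<rho> L x y g"
      "\<forall>y. \<forall>x\<in>tree_arc \<rho> y. f y - f x = tree_integral \<rho> L x y h" for g h
    using that by (intro AE_eq_of_arc_integrals) (simp_all flip: tree_integral_on_arc)
  obtain g where g: "g \<in> L1_loc L"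
    and eq: "\<And>x y. x \<in> tree_arc \<rho> y \<Longrightarrow> f y - f x = (LINT z:tree_arc x y|L. g z)"
    using density_exists[OF assms(4)] by blast
  \<comment> \<open>With \<open>c\<close> the branch point, subtract the identity on [c,x] from that
    on [c,y]; the terms \<open>f c\<close> cancel.\<close>
  have "f y - f x = tree_integral \<rho> L x y g" for x y
    using eq[OF branch_point_in_arcs(1)[of \<rho> x y]] eq[OF branch_point_in_arcs(2)[of \<rho> x y]]
    by (simp add: tree_integral_def)
  with g unique show ?thesis by blast
qed

end
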